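(* For an Abelian locally compact topological group $X$ endowed with its left coarse structure, the following conditions are equivalent: (1) $\mathcal S(X)=\mathcal D_<(X)$; (2) $X$ is compactly generated (i.e. algebraically generated by some compact subset); (3) $X$ is coarsely equivalent to the Euclidean space $\mathbb R^n$ for some $n\in\omega$.
   Context: A coarse space is a pair $(X,\mathcal E)$ of a set and a family of entourages $\varepsilon\subset X\times X$ that contain the diagonal, are symmetric, are (up to containment) closed under composition, and such that any symmetric $\delta$ with $\Delta_X\subset\delta\subset\varepsilon\in\mathcal E$ is in $\mathcal E$. The left coarse structure of a topological group $G$ has base $\{\{(x,y)\in G^2:x\in yK\}\}$, $K=K^{-1}$ ranging over compact symmetric subsets containing the identity; $\mathbb R^n$ carries the coarse structure of the Euclidean metric (base $\{(x,y):|x-y|<r\}$, $r<\infty$). Subsets carry the subspace coarse structure $\{\varepsilon\cap A^2\}$. $B(x,\varepsilon)=\{y:(x,y)\in\varepsilon\}$, $B(A,\varepsilon)=\bigcup_{a\in A}B(a,\varepsilon)$, $\operatorname{mesh}(\mathcal U)=\bigcup_{U\in\mathcal U}U\times U$. $\operatorname{asdim}(X)$ is the least $n\in\omega$ such that for every $\varepsilon\in\mathcal E$ there is a cover $\mathcal U$ of $X$ with $\operatorname{mesh}(\mathcal U)\subset\delta$ for some $\delta\in\mathcal E$ and each $B(x,\varepsilon)$ meeting at most $n+1$ members of $\mathcal U$ ($\infty$ if none). $A$ is large if $B(A,\varepsilon)=X$ for some $\varepsilon$; small if $L\setminus A$ is large for every large $L$; $\mathcal S(X)$ = small sets; $\mathcal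 D_<(X)=\{A:\operatorname{asdim}(A)<\operatorname{asdim}(X)\}$. A map is coarse if it maps pairs in any entourage into pairs in some entourage; a coarse equivalence is a coarse $f:X\to Y$ with a coarse $g:Y\to X$ such that $\{(x,gf(x))\}$ and $\{(y,fg(y))\}$ lie in some entourages.
   Formalization: The asymptotic dimension of the empty set is taken to be −1 instead of the value 0 given by "least n in ω"; with 0 the equivalence fails for compact X, where the empty set is small but would not lie in D_<(X). *)

theory Defs
  imports "HOL-Analysis.Analysis"
begin

definition cball_e :: "('a \<times> 'a) set \<Rightarrow> 'a \<Rightarrow> 'a set" where
  "cball_e \<epsilon> x = {y. (x, y) \<in> \<epsilon>}"

definition cballset_e :: "('a \<times> 'a) set \<Rightarrow> 'a set \<Rightarrow> 'a set" where
  "cballset_e \<epsilon> A = (\<Union>a\<in>A. cball_e \<epsilon> a)"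

definition mesh :: "'a set set \<Rightarrow> ('a \<times> 'a) set" where
  "mesh \<U> = (\<Union>U\<in>\<U>. U \<times> U)"

definition sub_coarse :: "'a set \<Rightarrow> ('a \<times> 'a) set set \<Rightarrow> ('a \<times> 'a) set set" where
  "sub_coarse A E = {\<epsilon> \<inter> (A \<times> A) | \<epsilon>. \<epsilon> \<in> E}"

definition asdim_le :: "'a set \<Rightarrow> ('a \<times> 'a) set set \<Rightarrow> nat \<Rightarrow> bool" where
  "asdim_le X E n \<longleftrightarrow>
     (\<forall>\<epsilon>\<in>E. \<exists>\<U>. \<Union>\<U> = X \<and> (\<exists>\<delta>\<in>E. mesh \<U> \<subseteq> \<delta>) \<and>
        (\<forall>x\<in>X. finite {U\<in>\<U>. U \<inter> cball_e \<epsilon> x \<noteq> {}} \<and>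
                card {U\<in>\<U>. U \<inter> cball_e \<epsilon> x \<noteq> {}} \<le> Suc n))"

definition asdim :: "'a set \<Rightarrow> ('a \<times> 'a) set set \<Rightarrow> ereal" where
  "asdim X E = (if X = {} then -1
                else if (\<exists>n. asdim_le X E n) then ereal (real (LEAST n. asdim_le X E n))
                else \<infinity>)"

definition large_set :: "'a set \<Rightarrow> ('a \<times> 'a) set set \<Rightarrow> 'a set \<Rightarrow> bool" where
  "large_set X E A \<longleftrightarrow> A \<subseteq> X \<and> (\<exists>\<epsilon>\<in>E. cballset_e \<epsilon> A = X)"

definition small_set :: "'a set \<Rightarrow> ('a \<times> 'a) set set \<Rightarrow> 'a set \<Rightarrow> bool" where
  "small_set X E A \<longleftrightarrow> A \<subseteq> X \<and> (\<forall>L. large_set X E L \<longrightarrow> large_set X E (L - A))"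

definition small_sets :: "'a set \<Rightarrow> ('a \<times> 'a) set set \<Rightarrow> 'a set set" where
  "small_sets X E = {A. small_set X E A}"

definition D_less :: "'a set \<Rightarrow> ('a \<times> 'a) set set \<Rightarrow> 'a set set" where
  "D_less X E = {A. A \<subseteq> X \<and> asdim A (sub_coarse A E) < asdim X E}"

definition coarse_map ::
  "'a set \<Rightarrow> ('a \<times> 'a) set set \<Rightarrow> 'b set \<Rightarrow> ('b \<times> 'b) set set \<Rightarrow> ('a \<Rightarrow> 'b) \<Rightarrow> bool" where
  "coarse_map X E Y F f \<longleftrightarrow> f ` X \<subseteq> Y \<and>
     (\<forall>\<epsilon>\<in>E. \<exists>\<delta>\<in>F. (\<lambda>(a, b). (f a, f b)) ` \<epsilon> \<subseteq> \<delta>)"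

definition coarse_equivalent ::
  "'a set \<Rightarrow> ('a \<times> 'a) set set \<Rightarrow> 'b set \<Rightarrow> ('b \<times> 'b) set set \<Rightarrow> bool" where
  "coarse_equivalent X E Y F \<longleftrightarrow>
     (\<exists>f g. coarse_map X E Y F f \<and> coarse_map Y F X E g \<and>
        (\<exists>\<epsilon>\<in>E. (\<lambda>x. (x, g (f x))) ` X \<subseteq> \<epsilon>) \<and>
        (\<exists>\<delta>\<in>F. (\<lambda>y. (y, f (g y))) ` Y \<subseteq> \<delta>))"

definition group_coarse :: "('a::{ab_group_add, topological_space} \<times> 'a) set set" where
  "group_coarse = {\<epsilon>. Id \<subseteq> \<epsilon> \<and> sym \<epsilon> \<and>
      (\<exists>K. compact K \<and> uminus ` K = K \<and> 0 \<in> K \<and> \<epsilon> \<subseteq> {(x, y). x \<in> (\<lambda>k. y + k) ` K})}"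

definition gen_subgroup :: "'a::ab_group_add set \<Rightarrow> 'a set" where
  "gen_subgroup K = \<Inter>{H. K \<subseteq> H \<and> 0 \<in> H \<and> (\<forall>x\<in>H. \<forall>y\<in>H. x + y \<in> H) \<and> (\<forall>x\<in>H. - x \<in> H)}"

definition compactly_generated :: "'a::{ab_group_add, topological_space} itself \<Rightarrow> bool" where
  "compactly_generated _ \<longleftrightarrow> (\<exists>K::'a set. compact K \<and> gen_subgroup K = UNIV)"

definition Rn :: "nat \<Rightarrow> (nat \<Rightarrow> real) set" where
  "Rn n = {x. \<forall>i\<ge>n. x i = 0}"

definition dist_n :: "nat \<Rightarrow> (nat \<Rightarrow> real) \<Rightarrow> (nat \<Rightarrow> real) \<Rightarrow> real" where
  "dist_n n x y = sqrt (\<Sum>i<n. (x i - y i)^2)"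

definition Rn_coarse :: "nat \<Rightarrow> ((nat \<Rightarrow> real) \<times> (nat \<Rightarrow> real)) set set" where
  "Rn_coarse n = {\<epsilon>. \<epsilon> \<subseteq> Rn n \<times> Rn n \<and> Id_on (Rn n) \<subseteq> \<epsilon> \<and> sym \<epsilon> \<and>
      (\<exists>r::real. \<epsilon> \<subseteq> {(x, y). dist_n n x y < r})}"

end

theory Submission
  imports Defs
begin

text \<open>
  Call a family \<open>y\<^sub>0, \<dots>, y\<^sub>n\<^sub>-\<^sub>1\<close> of group elements a proper lattice if the homomorphism from \<open>\<int>\<^sup>n\<close> that it
  defines pulls relatively compact sets back to finite ones. A relative form of Weil's lemma shows that a
  further element either extends such a lattice or generates a group that stays at bounded
  distance from it. Feeding in the finitely many elements that generate a compactly generated group up to a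
  compact set yields a cocompact proper lattice, hence a coarse equivalence with \<open>\<real>\<^sup>n\<close>.

  In the presence of a cocompact lattice of rank \<open>n\<close>, a set is small iff its asymptotic dimension is less
  than \<open>n\<close>. A small set misses a large ball in the middle of every large cube, so it can be pushed radially
  onto the boundaries of the cubes, and covering this skeleton by neighbourhoods of its faces gives
  dimension at most \<open>n - 1\<close>. A set that is not small contains, up to a compact set, arbitrarily large lattice
  cubes, and Lebesgue's covering theorem applies.

  A subgroup is small unless its sum with some compact set is the whole group. Suppose that the group is not
  compactly generated. If some proper lattice is maximal, it is small and has the asymptotic
  dimension of the whole group. Otherwise there is an infinite
  sequence of independent elements, and omitting its first member leaves the basis of a small subgroup
  of infinite asymptotic dimension.
\<close>

section \<open>Colouring lattice points by nearby faces\<close>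

text \<open>No decomposition of the group as \<real>^a x \<int>^b x compact is used: coarsely only
  \<int>^n matters, and every statement carries a relatively compact error set instead.

  If a proper lattice is maximal, its rank bounds the dimension of the whole group for this reason:
  at scale \<open>B\<close> the cosets of the subgroup generated by \<open>B\<close> do not
  interact, this subgroup is close to the lattice by maximality, and all cosets can be coloured by
  translating one colouring.

  The delicate case is infinite rank. Every finite part of the sequence is proper, but the bounds
  depend on its length, so the span of the whole sequence need not be discrete. The sequence
  therefore starts with a lattice that is cocompact in the subgroup generated by a neighbourhood of
  0. A combination that falls into this subgroup involves only the initial part, so the properness
  of one finite lattice suffices. The omitted first member witnesses smallness: its multiples cannot
  all stay at bounded distance from the span of the others.\<close>

definition dist_int :: "real \<Rightarrow> real" where
  "dist_int t = \<bar>t - of_int (round t)\<bar>"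

lemma dist_int_le: "dist_int t \<le> \<bar>t - of_int m\<bar>"
  unfolding dist_int_def by (rule round_diff_minimal)

lemma dist_int_triangle: "dist_int s \<le> dist_int t + \<bar>s - t\<bar>"
  using dist_int_le[of s "round t"] unfolding dist_int_def by linarith

lemma dist_int_of_int [simp]: "dist_int (of_int m) = 0"
  by (simp add: dist_int_def)

text \<open>The tolerance \<open>\<eta> * j\<close> for lying near a face of codimension \<open>j\<close> grows with \<open>j\<close>, so that two points
  at distance at most \<open>\<eta>\<close> with the same maximal \<open>j\<close> lie near the same face.\<close>

definition near_int :: "nat \<Rightarrow> real \<Rightarrow> (nat \<Rightarrow> real) \<Rightarrow> nat \<Rightarrow> nat set" where
  "near_int n \<eta> z j = {i. i < n \<and> dist_int (z i) \<le> \<eta> * real j}"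

definition codim :: "nat \<Rightarrow> real \<Rightarrow> (nat \<Rightarrow> real) \<Rightarrow> nat" where
  "codim n \<eta> z = Max {j. j \<le> n \<and> j \<le> card (near_int n \<eta> z j)}"

text \<open>The label does not record which coordinates are near integers. Points with equal labels
  are close in any case, and distinguishing faces is needed only among points of equal
  \<open>codim\<close> at distance at most \<eta>.\<close>

definition face_label :: "nat \<Rightarrow> real \<Rightarrow> (nat \<Rightarrow> real) \<Rightarrow> nat \<Rightarrow> int" where
  "face_label n \<eta> z i =
     (if i < n then if i \<in> near_int n \<eta> z (codim n \<eta> z) then round (z i) else \<lfloor>z i\<rfloor> else 0)"

lemma finite_near_int [simp]: "finite (near_int n \<eta> z j)"
  by (simp add: near_int_def)

lemma near_int_subset: "near_int n \<eta> z j \<subseteq> {..<n}"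
  by (auto simp: near_int_def)

lemma near_int_mono: "0 \<le> \<eta> \<Longrightarrow> j \<le> k \<Longrightarrow> near_int n \<eta> z j \<subseteq> near_int n \<eta> z k"
  using mult_left_mono[of "real j" "real k" \<eta>] by (auto simp: near_int_def)

lemma codim_props:
  "codim n \<eta> z \<le> n" "codim n \<eta> z \<le> card (near_int n \<eta> z (codim n \<eta> z))"
proof -
  have "finite {j. j \<le> n \<and> j \<le> card (near_int n \<eta> z j)}"
    by (rule finite_subset[of _ "{..n}"]) auto
  moreover have "0 \<in> {j. j \<le> n \<and> j \<le> card (near_int n \<eta> z j)}" by simp
  ultimately have "codim n \<eta> z \<in> {j. j \<le> n \<and> j \<le> card (near_int n \<eta> z j)}"
    unfolding codim_def by (intro Max_in) blast+
  then show "codim n \<eta> z \<le> n" "codim n \<eta> z \<le> card (near_int n \<eta> z (codim n \<eta> z))"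
    by auto
qed

lemma codim_ge: "j \<le> n \<Longrightarrow> j \<le> card (near_int n \<eta> z j) \<Longrightarrow> j \<le> codim n \<eta> z"
  unfolding codim_def by (rule Max_ge) (auto intro: finite_subset[of _ "{..n}"])

lemma codim_pos:
  assumes "i < n" "z i \<in> \<int>" "0 \<le> \<eta>"
  shows "1 \<le> codim n \<eta> z"
proof (rule codim_ge)
  have "i \<in> near_int n \<eta> z 1"
    using assms by (auto simp: near_int_def elim: Ints_cases)
  then have "0 < card (near_int n \<eta> z 1)"
    by (subst card_gt_0_iff) auto
  then show "1 \<le> card (near_int n \<eta> z 1)" by simp
qed (use assms in auto)

text \<open>By maximality of \<open>codim\<close>, at most \<open>codim\<close> coordinates satisfy
  the next tolerance, and that many satisfy the present one already. So the band between the two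
  tolerances is empty.\<close>

lemma near_int_codim_stable:
  assumes "0 \<le> \<eta>" "codim n \<eta> z < n"
  shows "near_int n \<eta> z (Suc (codim n \<eta> z)) = near_int n \<eta> z (codim n \<eta> z)"
proof -
  let ?j = "codim n \<eta> z"
  have "\<not> Suc ?j \<le> card (near_int n \<eta> z (Suc ?j))"
    using codim_ge[of "Suc ?j" n \<eta> z] assms by auto
  then show ?thesis
    using codim_props(2)[of n \<eta> z] near_int_mono[OF assms(1), of ?j "Suc ?j" n z]
      card_mono[of "near_int n \<eta> z (Suc ?j)" "near_int n \<eta> z ?j"]
    by (intro card_subset_eq[symmetric]) simp_all
qed

lemma near_int_codim_full:
  assumes "codim n \<eta> z = n"
  shows "near_int n \<eta> z n = {..<n}"
  using codim_props(2)[of n \<eta> z] assms near_int_subset[of n \<eta> z n]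
    card_mono[of "{..<n}" "near_int n \<eta> z n"]
  by (intro card_subset_eq) simp_all

text \<open>A move by at most \<eta> costs one step of tolerance, and the empty band absorbs this
  step. When \<open>codim\<close> is \<open>n\<close> there is no next step, but then every
  coordinate is near.\<close>

lemma near_int_codim_cong:
  assumes "0 \<le> \<eta>" and "\<And>i. i < n \<Longrightarrow> \<bar>z i - w i\<bar> \<le> \<eta>" and "codim n \<eta> z = codim n \<eta> w"
  shows "near_int n \<eta> w (codim n \<eta> w) \<subseteq> near_int n \<eta> z (codim n \<eta> z)"
proof (cases "codim n \<eta> z < n")
  case True
  have "near_int n \<eta> w (codim n \<eta> w) \<subseteq> near_int n \<eta> z (Suc (codim n \<eta> z))"
  proof
    fix i assume i: "i \<in> near_int n \<eta> w (codim n \<eta> w)"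
    then have "dist_int (z i) \<le> dist_int (w i) + \<eta>"
      using dist_int_triangle[of "z i" "w i"] assms(2)[of i] by (auto simp: near_int_def)
    then show "i \<in> near_int n \<eta> z (Suc (codim n \<eta> z))"
      using i assms(3) by (auto simp: near_int_def algebra_simps)
  qed
  then show ?thesis using near_int_codim_stable[OF assms(1) True] by simp
next
  case False
  then have "codim n \<eta> z = n" using codim_props(1)[of n \<eta> z] by simp
  then show ?thesis using near_int_codim_full[of n \<eta> z] near_int_subset by simp
qed

lemma floor_eq_if_far:
  assumes "\<bar>s - t\<bar> \<le> \<eta>" "\<eta> < dist_int s" "\<eta> < dist_int t"
  shows "\<lfloor>s\<rfloor> = \<lfloor>t\<rfloor>"
proof -
  have *: "\<not> \<lfloor>a\<rfloor> < \<lfloor>b\<rfloor>" if "\<bar>a - b\<bar> \<le> \<eta>" "\<eta> < dist_int a" for a b :: real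
  proof
    assume "\<lfloor>a\<rfloor> < \<lfloor>b\<rfloor>"
    then have "a < of_int \<lfloor>b\<rfloor>" by linarith
    then show False
      using dist_int_le[of a "\<lfloor>b\<rfloor>"] that of_int_floor_le[of b] by linarith
  qed
  show ?thesis using *[of s t] *[of t s] assms by (auto simp: abs_minus_commute)
qed

text \<open>Near coordinates are within n\<eta> of their roundings, so the two roundings differ by
  at most (2n + 1)\<eta> < 1 and agree. The other coordinates are further than \<eta> from every
  integer, so no integer separates them.\<close>

lemma face_label_cong:
  assumes \<eta>: "0 < \<eta>" "(2 * real n + 1) * \<eta> < 1"
    and near: "\<And>i. i < n \<Longrightarrow> \<bar>z i - w i\<bar> \<le> \<eta>" and eq: "codim n \<eta> z = codim n \<eta> w"
  shows "face_label n \<eta> z = face_label n \<eta> w"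
proof
  fix i
  let ?j = "codim n \<eta> z"
  have S: "near_int n \<eta> z ?j = near_int n \<eta> w ?j"
    using near_int_codim_cong[of \<eta> n z w] near_int_codim_cong[of \<eta> n w z] assms
    by (auto simp: abs_minus_commute)
  show "face_label n \<eta> z i = face_label n \<eta> w i"
  proof (cases "i < n")
    case i: True
    show ?thesis
    proof (cases "i \<in> near_int n \<eta> z ?j")
      case True
      have "\<eta> * real ?j \<le> \<eta> * real n"
        using \<eta> codim_props(1) by (intro mult_left_mono) auto
      then have d: "dist_int (z i) \<le> \<eta> * real n" "dist_int (w i) \<le> \<eta> * real n"
        using True True[unfolded S] unfolding near_int_def by simp_all
      have "\<bar>real_of_int (round (z i)) - of_int (round (w i))\<bar> < 1"
      proof -
        have "2 * (\<eta> * real n) + \<eta> < 1" using \<eta> by (simp add: algebra_simps)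
        then show ?thesis
          using d near[OF i] unfolding dist_int_def by linarith
      qed
      then have "round (z i) = round (w i)" by linarith
      then show ?thesis using True S i eq by (simp add: face_label_def)
    next
      case False
      then have lt: "?j < n"
        using near_int_codim_full[of n \<eta> z] codim_props(1)[of n \<eta> z] i by (cases "?j = n") auto
      have "i \<notin> near_int n \<eta> z (Suc ?j)" "i \<notin> near_int n \<eta> w (Suc ?j)"
        using near_int_codim_stable[of \<eta> n z] near_int_codim_stable[of \<eta> n w] False S lt \<eta> eq
        by auto
      then have "\<eta> * real (Suc ?j) < dist_int (z i)" "\<eta> * real (Suc ?j) < dist_int (w i)"
        using i by (auto simp: near_int_def)
      moreover have "\<eta> \<le> \<eta> * real (Suc ?j)" using \<eta> by (simp add: algebra_simps)
      ultimately have "\<lfloor>z i\<rfloor> = \<lfloor>w i\<rfloor>"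
        using near[OF i] by (intro floor_eq_if_far[of _ _ \<eta>]) auto
      then show ?thesis using False S i eq by (simp add: face_label_def)
    qed
  qed (simp add: face_label_def)
qed

lemma face_label_close: "i < n \<Longrightarrow> \<bar>z i - of_int (face_label n \<eta> z i)\<bar> \<le> 1"
proof -
  have "\<bar>z i - of_int \<lfloor>z i\<rfloor>\<bar> \<le> 1" by linarith
  then show "i < n \<Longrightarrow> ?thesis"
    using round_diff_minimal[of "z i" "\<lfloor>z i\<rfloor>"] unfolding face_label_def by auto
qed

section \<open>The gauge of a unit cube and the radial projection onto its boundary\<close>

text \<open>The Minkowski functional of \<open>[q - c, q + 1 - c]\<close> at \<open>t - c\<close>.\<close>

definition gauge1 :: "real \<Rightarrow> real \<Rightarrow> real \<Rightarrow> real" where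
  "gauge1 q c t = max ((t - c) / (q + 1 - c)) ((c - t) / (c - q))"

context
  fixes q c :: real
  assumes mid: "q + 1/3 \<le> c" "c \<le> q + 2/3"
begin

text \<open>A centre in the middle third is at least 1/3 away from both ends, so both slopes are at
  most 3.\<close>

lemma gauge1_lipschitz: "\<bar>gauge1 q c s - gauge1 q c t\<bar> \<le> 3 * \<bar>s - t\<bar>"
proof -
  have *: "\<bar>u\<bar> / d \<le> 3 * \<bar>u\<bar>" if "1/3 \<le> d" for u d :: real
  proof -
    have "\<bar>u\<bar> * 1 \<le> \<bar>u\<bar> * (3 * d)" using that by (intro mult_left_mono) auto
    then show ?thesis using that by (simp add: field_simps)
  qed
  have "\<bar>(s - c) / (q + 1 - c) - (t - c) / (q + 1 - c)\<bar> \<le> 3 * \<bar>s - t\<bar>"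
    using *[of "q + 1 - c" "s - t"] mid by (simp flip: diff_divide_distrib)
  moreover have "\<bar>(c - s) / (c - q) - (c - t) / (c - q)\<bar> \<le> 3 * \<bar>s - t\<bar>"
    using *[of "c - q" "s - t"] mid by (simp flip: diff_divide_distrib add: abs_minus_commute)
  ultimately show ?thesis unfolding gauge1_def by linarith
qed

lemma gauge1_ge: "\<bar>t - c\<bar> \<le> gauge1 q c t"
proof -
  have *: "u \<le> u / d" if "0 \<le> u" "0 < d" "d \<le> 1" for u d :: real
    using that mult_left_mono[of d 1 u] by (simp add: field_simps)
  show ?thesis
    using *[of "t - c" "q + 1 - c"] *[of "c - t" "c - q"] mid
    unfolding gauge1_def by (cases "c \<le> t") auto
qed

lemma gauge1_le_1_iff: "gauge1 q c t \<le> 1 \<longleftrightarrow> q \<le> t \<and> t \<le> q + 1"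
  using mid by (auto simp: gauge1_def)

lemma gauge1_eq_1: "gauge1 q c t = 1 \<Longrightarrow> t = q \<or> t = q + 1"
  using mid by (auto simp: gauge1_def max_def divide_eq_1_iff split: if_splits)

lemma gauge1_end: "gauge1 q c q = 1" "gauge1 q c (q + 1) = 1"
proof -
  have "(q - c) / (q + 1 - c) \<le> 0" "(c - (q + 1)) / (c - q) \<le> 0"
    using mid by (auto intro: divide_nonpos_pos)
  then show "gauge1 q c q = 1" "gauge1 q c (q + 1) = 1"
    using mid by (auto simp: gauge1_def max_def)
qed

lemma gauge1_scale:
  assumes "0 < s"
  shows "gauge1 q c (c + (t - c) / s) = gauge1 q c t / s"
proof -
  have "max (a / s) (b / s) = max a b / s" for a b
    using assms by (auto simp: max_def divide_le_cancel)
  moreover have "(c + (t - c) / s - c) / (q + 1 - c) = ((t - c) / (q + 1 - c)) / s"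
    by (simp add: field_simps)
  moreover have "(c - (c + (t - c) / s)) / (c - q) = ((c - t) / (c - q)) / s"
  proof -
    have "c - (c + (t - c) / s) = (c - t) / s" by (simp add: diff_divide_distrib)
    then show ?thesis by (simp add: mult.commute)
  qed
  ultimately show ?thesis unfolding gauge1_def by metis
qed

end

definition gauge_cube :: "nat \<Rightarrow> (nat \<Rightarrow> int) \<Rightarrow> (nat \<Rightarrow> real) \<Rightarrow> (nat \<Rightarrow> real) \<Rightarrow> real" where
  "gauge_cube n q c x = Max ((\<lambda>i. gauge1 (of_int (q i)) (c i) (x i)) ` {..<n})"

text \<open>Central projection from \<open>c\<close> onto the boundary of the cube with lower corner
  \<open>q\<close>; \<open>c\<close> need not be the midpoint. Where the gauge vanishes the formula
  returns \<open>c\<close>, a case excluded below by positivity.\<close>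

definition radial :: "nat \<Rightarrow> (nat \<Rightarrow> int) \<Rightarrow> (nat \<Rightarrow> real) \<Rightarrow> (nat \<Rightarrow> real) \<Rightarrow> nat \<Rightarrow> real" where
  "radial n q c x i = c i + (x i - c i) / gauge_cube n q c x"

context
  fixes n :: nat and q :: "nat \<Rightarrow> int" and c :: "nat \<Rightarrow> real"
  assumes n_pos: "0 < n"
    and mid: "\<And>i. i < n \<Longrightarrow> of_int (q i) + 1/3 \<le> c i" "\<And>i. i < n \<Longrightarrow> c i \<le> of_int (q i) + 2/3"
begin

lemma gauge_cube_ge: "i < n \<Longrightarrow> gauge1 (of_int (q i)) (c i) (x i) \<le> gauge_cube n q c x"
  unfolding gauge_cube_def by (rule Max_ge) auto

lemma gauge_cube_attained: "\<exists>i<n. gauge_cube n q c x = gauge1 (of_int (q i)) (c i) (x i)"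
proof -
  have "gauge_cube n q c x \<in> (\<lambda>i. gauge1 (of_int (q i)) (c i) (x i)) ` {..<n}"
    unfolding gauge_cube_def using n_pos by (intro Max_in) auto
  then show ?thesis by auto
qed

lemma gauge_cube_ge_abs: "i < n \<Longrightarrow> \<bar>x i - c i\<bar> \<le> gauge_cube n q c x"
  using gauge_cube_ge[of i x] gauge1_ge[OF mid, of i "x i"] by linarith

lemma gauge_cube_lipschitz:
  assumes "\<And>i. i < n \<Longrightarrow> \<bar>x i - y i\<bar> \<le> \<rho>"
  shows "gauge_cube n q c x \<le> gauge_cube n q c y + 3 * \<rho>"
proof -
  obtain i where i: "i < n" "gauge_cube n q c x = gauge1 (of_int (q i)) (c i) (x i)"
    using gauge_cube_attained by blast
  have "\<bar>gauge1 (of_int (q i)) (c i) (x i) - gauge1 (of_int (q i)) (c i) (y i)\<bar> \<le> 3 * \<rho>"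
    using gauge1_lipschitz[OF mid, OF i(1) i(1), of "x i" "y i"] assms[OF i(1)] by simp
  then show ?thesis using i(2) gauge_cube_ge[OF i(1), of y] by linarith
qed

text \<open>The constant is 4 = 1 + 3: the move of the point itself plus the change of the gauge.
  Only one of the points needs gauge at least \<open>h\<close>, so the other may be a boundary
  point, whatever \<open>h\<close> is.\<close>

lemma radial_lipschitz:
  assumes h: "0 < h" "h \<le> gauge_cube n q c x" and pos: "0 < gauge_cube n q c y"
    and near: "\<And>i. i < n \<Longrightarrow> \<bar>x i - y i\<bar> \<le> \<rho>" and i: "i < n"
  shows "\<bar>radial n q c x i - radial n q c y i\<bar> \<le> 4 * \<rho> / h"
proof -
  define s t a b where "s = gauge_cube n q c x" and "t = gauge_cube n q c y"
    and "a = x i - c i" and "b = y i - c i"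
  have st: "0 < s" "0 < t" "h \<le> s" using h pos by (auto simp: s_def t_def)
  have lip: "\<bar>t - s\<bar> \<le> 3 * \<rho>"
    using gauge_cube_lipschitz[of x y \<rho>] gauge_cube_lipschitz[of y x \<rho>] near
    by (auto simp: s_def t_def abs_minus_commute)
  have ab: "\<bar>a - b\<bar> \<le> \<rho>" using near[OF i] by (simp add: a_def b_def)
  have b: "\<bar>b / t\<bar> \<le> 1" using gauge_cube_ge_abs[OF i, of y] st by (simp add: b_def t_def)
  have "\<rho> \<ge> 0" using ab by linarith
  have "a / s - b / t = ((a - b) + (b / t) * (t - s)) / s"
    using st by (simp add: field_simps)
  then have "\<bar>a / s - b / t\<bar> = \<bar>(a - b) + (b / t) * (t - s)\<bar> / s"
    using st by (simp add: abs_divide)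
  also have "\<dots> \<le> (4 * \<rho>) / s"
  proof (rule divide_right_mono)
    have "\<bar>(b / t) * (t - s)\<bar> \<le> 1 * (3 * \<rho>)"
      unfolding abs_mult using b lip by (intro mult_mono) auto
    then show "\<bar>(a - b) + (b / t) * (t - s)\<bar> \<le> 4 * \<rho>" using ab by linarith
  qed (use st in auto)
  also have "\<dots> \<le> 4 * \<rho> / h"
    using st h \<open>\<rho> \<ge> 0\<close> by (intro divide_left_mono) auto
  finally show ?thesis by (simp add: radial_def a_def b_def s_def t_def)
qed

lemma gauge1_radial:
  assumes "0 < gauge_cube n q c x" "i < n"
  shows "gauge1 (of_int (q i)) (c i) (radial n q c x i)
    = gauge1 (of_int (q i)) (c i) (x i) / gauge_cube n q c x"
  unfolding radial_def using assms mid by (intro gauge1_scale) auto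

lemma radial_in_cube:
  assumes "0 < gauge_cube n q c x" "i < n"
  shows "of_int (q i) \<le> radial n q c x i" "radial n q c x i \<le> of_int (q i) + 1"
  using gauge1_le_1_iff[OF mid, OF assms(2,2), of "radial n q c x i"] gauge1_radial[OF assms]
    gauge_cube_ge[OF assms(2), of x] assms(1) by auto

lemma radial_integral_coordinate:
  assumes "0 < gauge_cube n q c x"
  shows "\<exists>i<n. radial n q c x i \<in> \<int>"
proof -
  obtain i where i: "i < n" "gauge_cube n q c x = gauge1 (of_int (q i)) (c i) (x i)"
    using gauge_cube_attained by blast
  then have "gauge1 (of_int (q i)) (c i) (radial n q c x i) = 1"
    using gauge1_radial[OF assms i(1)] assms by auto
  then have "radial n q c x i = of_int (q i) \<or> radial n q c x i = of_int (q i) + 1"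
    using mid i(1) by (intro gauge1_eq_1) auto
  then show ?thesis using i(1) by (metis Ints_of_int Ints_1 Ints_add)
qed

lemma gauge_cube_boundary:
  assumes "\<And>i. i < n \<Longrightarrow> of_int (q i) \<le> x i \<and> x i \<le> of_int (q i) + 1"
    and "j < n" "x j = of_int (q j) \<or> x j = of_int (q j) + 1"
  shows "gauge_cube n q c x = 1"
proof (rule antisym)
  obtain i where i: "i < n" "gauge_cube n q c x = gauge1 (of_int (q i)) (c i) (x i)"
    using gauge_cube_attained by blast
  then show "gauge_cube n q c x \<le> 1"
    using gauge1_le_1_iff[OF mid, OF i(1) i(1), of "x i"] assms(1)[OF i(1)] by simp
  have "gauge1 (of_int (q j)) (c j) (x j) = 1"
    using assms(3) gauge1_end[OF mid, OF assms(2,2)] by auto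
  then show "1 \<le> gauge_cube n q c x" using gauge_cube_ge[OF assms(2), of x] by simp
qed

end

text \<open>The radial projections of neighbouring cubes are glued along common boundary points,
  which they fix.\<close>

lemma radial_lipschitz_across_cubes:
  fixes x y :: "nat \<Rightarrow> real" and cen :: "(nat \<Rightarrow> int) \<Rightarrow> nat \<Rightarrow> real" and n :: nat
  defines "cell \<equiv> \<lambda>x i. if i < n then \<lfloor>x i :: real\<rfloor> else 0"
  assumes n_pos: "0 < n"
    and mid: "\<And>q i. i < n \<Longrightarrow> of_int (q i) + 1/3 \<le> cen q i"
      "\<And>q i. i < n \<Longrightarrow> cen q i \<le> of_int (q i) + 2/3"
    and \<rho>: "\<rho> < 1" and h: "0 < h"
    and hx: "h \<le> gauge_cube n (cell x) (cen (cell x)) x"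
    and hy: "h \<le> gauge_cube n (cell y) (cen (cell y)) y"
    and near: "\<And>i. i < n \<Longrightarrow> \<bar>x i - y i\<bar> \<le> \<rho>"
    and i: "i < n"
  shows "\<bar>radial n (cell x) (cen (cell x)) x i - radial n (cell y) (cen (cell y)) y i\<bar> \<le> 8 * \<rho> / h"
proof (cases "cell x = cell y")
  case True
  have "\<bar>radial n (cell x) (cen (cell x)) x i - radial n (cell x) (cen (cell x)) y i\<bar> \<le> 4 * \<rho> / h"
    using hx hy h near i True by (intro radial_lipschitz[OF n_pos mid]) auto
  moreover have "4 * \<rho> / h \<le> 8 * \<rho> / h"
    using near[OF i] h by (intro divide_right_mono) auto
  ultimately show ?thesis using True by simp
next
  case False
  \<comment> \<open>Since \<rho> < 1, the floors differ by at most 1, and the larger one is the wall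
    that separates \<open>x i\<close> from \<open>y i\<close>. Replacing these coordinates by their
    walls gives a point on the boundary of both cubes, within \<rho> of \<open>x\<close> and of
    \<open>y\<close>.\<close>
  define z where "z i = (if cell x i = cell y i then x i else of_int (max (cell x i) (cell y i)))" for i
  have cube: "of_int (cell x i) \<le> z i \<and> z i \<le> of_int (cell x i) + 1
      \<and> of_int (cell y i) \<le> z i \<and> z i \<le> of_int (cell y i) + 1
      \<and> \<bar>x i - z i\<bar> \<le> \<rho> \<and> \<bar>z i - y i\<bar> \<le> \<rho>
      \<and> (cell x i \<noteq> cell y i \<longrightarrow> (z i = of_int (cell x i) \<or> z i = of_int (cell x i) + 1)
            \<and> (z i = of_int (cell y i) \<or> z i = of_int (cell y i) + 1))"
    if "i < n" for i
  proof -
    define a b where "a = \<lfloor>x i\<rfloor>" and "b = \<lfloor>y i\<rfloor>"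
    have ab: "of_int a \<le> x i" "x i < of_int a + 1" "of_int b \<le> y i" "y i < of_int b + 1"
      by (auto simp: a_def b_def)
    have d: "\<bar>x i - y i\<bar> \<le> \<rho>" by (rule near[OF that])
    have cl: "cell x i = a" "cell y i = b" using that by (auto simp: cell_def a_def b_def)
    consider "a = b" | "a < b" | "b < a" by linarith
    then show ?thesis
    proof cases
      case 1
      then show ?thesis using ab d unfolding z_def cl by auto
    next
      case 2
      then have "of_int a + 1 \<le> (of_int b :: real)" by linarith
      moreover have "of_int b < (of_int a + 2 :: real)" using ab d \<rho> by linarith
      ultimately have "b = a + 1" by linarith
      then show ?thesis using ab d unfolding z_def cl by auto
    next
      case 3
      then have "of_int b + 1 \<le> (of_int a :: real)" by linarith
      moreover have "of_int a < (of_int b + 2 :: real)" using ab d \<rho> by linarith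
      ultimately have "a = b + 1" by linarith
      then show ?thesis using ab d unfolding z_def cl by auto
    qed
  qed
  obtain j where "cell x j \<noteq> cell y j" using False by auto
  then have j: "j < n" "cell x j \<noteq> cell y j" by (auto simp: cell_def split: if_splits)
  have gx: "gauge_cube n (cell x) (cen (cell x)) z = 1"
    by (rule gauge_cube_boundary[OF n_pos mid]) (use cube j in auto)
  have gy: "gauge_cube n (cell y) (cen (cell y)) z = 1"
    by (rule gauge_cube_boundary[OF n_pos mid]) (use cube j in auto)
  have "\<bar>radial n (cell x) (cen (cell x)) x i - radial n (cell x) (cen (cell x)) z i\<bar> \<le> 4 * \<rho> / h"
    by (rule radial_lipschitz[OF n_pos mid]) (use h hx gx cube i in auto)
  moreover have
    "\<bar>radial n (cell y) (cen (cell y)) y i - radial n (cell y) (cen (cell y)) z i\<bar> \<le> 4 * \<rho> / h"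
    by (rule radial_lipschitz[OF n_pos mid]) (use h hy gy cube i in \<open>auto simp: abs_minus_commute\<close>)
  ultimately show ?thesis using gx gy by (simp add: radial_def)
qed

section \<open>Colourings of subsets of the integer lattice\<close>

text \<open>The coloured form of asymptotic dimension at most \<open>m\<close> for the maximum norm
  on \<int>^n: with \<open>m + 1\<close> colours, distinct classes of one colour are more than
  \<open>r\<close> apart and all classes are bounded by a common \<open>D\<close>.\<close>

definition colourable :: "nat \<Rightarrow> (nat \<Rightarrow> int) set \<Rightarrow> nat \<Rightarrow> bool" where
  "colourable n S m \<longleftrightarrow> (\<forall>r. \<exists>(k :: (nat \<Rightarrow> int) \<Rightarrow> nat) (l :: (nat \<Rightarrow> int) \<Rightarrow> nat \<Rightarrow> int) D.
     (\<forall>x\<in>S. k x \<le> m) \<and>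
     (\<forall>x\<in>S. \<forall>y\<in>S. k x = k y \<longrightarrow> (\<forall>i<n. \<bar>x i - y i\<bar> \<le> r) \<longrightarrow> l x = l y) \<and>
     (\<forall>x\<in>S. \<forall>y\<in>S. l x = l y \<longrightarrow> (\<forall>i<n. \<bar>x i - y i\<bar> \<le> D)))"

text \<open>The colour of a point is \<open>n - codim\<close> of its image under \<open>P\<close>,
  the label is the face label. An image in which \<open>codim\<close> is always at least
  \<open>d\<close> saves \<open>d\<close> colours. Closeness of \<open>P x\<close> to
  \<open>x\<close> scaled by \<open>1/R\<close> makes the classes bounded.\<close>

lemma colourable_if_approximable:
  fixes n d :: nat and S :: "(nat \<Rightarrow> int) set"
  defines "\<eta> \<equiv> 1 / (2 * real n + 2)"
  assumes "\<And>r::int. \<exists>(R::int) P. 0 < R \<and> (\<forall>x\<in>S. \<forall>i<n. \<bar>P x i - of_int (x i) / of_int R\<bar> \<le> 1)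
    \<and> (\<forall>x\<in>S. \<forall>y\<in>S. (\<forall>i<n. \<bar>x i - y i\<bar> \<le> r) \<longrightarrow> (\<forall>i<n. \<bar>P x i - P y i\<bar> \<le> \<eta>))
    \<and> (\<forall>x\<in>S. d \<le> codim n \<eta> (P x))"
  shows "colourable n S (n - d)"
  unfolding colourable_def
proof
  fix r :: int
  obtain R P where R: "0 < R"
    and close: "\<And>x i. x \<in> S \<Longrightarrow> i < n \<Longrightarrow> \<bar>P x i - of_int (x i) / of_int R\<bar> \<le> 1"
    and lip: "\<And>x y i. x \<in> S \<Longrightarrow> y \<in> S \<Longrightarrow> (\<forall>i<n. \<bar>x i - y i\<bar> \<le> r) \<Longrightarrow> i < n \<Longrightarrow> \<bar>P x i - P y i\<bar> \<le> \<eta>"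
    and d: "\<And>x. x \<in> S \<Longrightarrow> d \<le> codim n \<eta> (P x)"
    using assms(2)[of r] by blast
  have \<eta>: "0 < \<eta>" "(2 * real n + 1) * \<eta> < 1" by (auto simp: \<eta>_def field_simps)
  show "\<exists>k l D. (\<forall>x\<in>S. k x \<le> n - d) \<and>
     (\<forall>x\<in>S. \<forall>y\<in>S. k x = k y \<longrightarrow> (\<forall>i<n. \<bar>x i - y i\<bar> \<le> r) \<longrightarrow> l x = (l y :: nat \<Rightarrow> int)) \<and>
     (\<forall>x\<in>S. \<forall>y\<in>S. l x = l y \<longrightarrow> (\<forall>i<n. \<bar>x i - y i\<bar> \<le> D))"
  proof (intro exI conjI ballI impI allI)
    fix x assume "x \<in> S"
    then show "n - codim n \<eta> (P x) \<le> n - d" using d by (auto intro: diff_le_mono2)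
  next
    fix x y assume xy: "x \<in> S" "y \<in> S" "n - codim n \<eta> (P x) = n - codim n \<eta> (P y)"
      "\<forall>i<n. \<bar>x i - y i\<bar> \<le> r"
    have "codim n \<eta> (P x) = codim n \<eta> (P y)"
      using xy(3) codim_props(1)[of n \<eta> "P x"] codim_props(1)[of n \<eta> "P y"] by linarith
    then show "face_label n \<eta> (P x) = face_label n \<eta> (P y)"
      by (intro face_label_cong \<eta> lip xy)
  next
    fix x y i assume xy: "x \<in> S" "y \<in> S" "face_label n \<eta> (P x) = face_label n \<eta> (P y)" "i < n"
    have "\<bar>P x i - P y i\<bar> \<le> 2"
      using face_label_close[OF xy(4), of "P x" \<eta>] face_label_close[OF xy(4), of "P y" \<eta>] xy(3)
      by auto
    then have "\<bar>of_int (x i) / of_int R - of_int (y i) / of_int R\<bar> \<le> (4::real)"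
      using close[OF xy(1,4)] close[OF xy(2,4)] by linarith
    then have "\<bar>of_int (x i) - of_int (y i)\<bar> / of_int R \<le> (4::real)"
      using R by (simp flip: diff_divide_distrib add: abs_divide)
    then have "\<bar>of_int (x i) - of_int (y i)\<bar> \<le> 4 * (of_int R :: real)"
      using R by (simp add: field_simps)
    then show "\<bar>x i - y i\<bar> \<le> 4 * R" by linarith
  qed
qed

lemma colourable_UNIV: "colourable n UNIV n"
proof -
  have "colourable n UNIV (n - 0)"
  proof (rule colourable_if_approximable)
    fix r :: int
    let ?R = "(2 * int n + 2) * (\<bar>r\<bar> + 1)" and ?\<eta> = "1 / (2 * real n + 2)"
    let ?P = "\<lambda>(x::nat \<Rightarrow> int) i. real_of_int (x i) / of_int ?R"
    have "\<bar>?P x i - ?P y i\<bar> \<le> ?\<eta>" if "\<forall>i<n. \<bar>x i - y i\<bar> \<le> r" "i < n" for x y i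
    proof -
      have "\<bar>of_int (x i) - of_int (y i)\<bar> \<le> real_of_int (\<bar>r\<bar> + 1)" using that by fastforce
      then have "\<bar>of_int (x i) - of_int (y i)\<bar> / real_of_int ?R \<le> real_of_int (\<bar>r\<bar> + 1) / real_of_int ?R"
        by (intro divide_right_mono) auto
      also have "\<dots> = 1 / (2 * real n + 2)"
      proof -
        have "real_of_int (\<bar>r\<bar> + 1) \<noteq> 0" by linarith
        then show ?thesis unfolding of_int_mult by simp
      qed
      finally show ?thesis
        by (simp flip: diff_divide_distrib add: abs_divide)
    qed
    then show "\<exists>(R::int) P. 0 < R \<and> (\<forall>x\<in>UNIV. \<forall>i<n. \<bar>P x i - real_of_int (x i) / of_int R\<bar> \<le> 1)
      \<and> (\<forall>x\<in>UNIV. \<forall>y\<in>UNIV. (\<forall>i<n. \<bar>x i - y i\<bar> \<le> r) \<longrightarrow> (\<forall>i<n. \<bar>P x i - P y i\<bar> \<le> ?\<eta>))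
      \<and> (\<forall>x\<in>UNIV. 0 \<le> codim n ?\<eta> (P x))"
      by (intro exI[of _ ?R] exI[of _ ?P]) auto
  qed
  then show ?thesis by simp
qed

text \<open>The holes provide centres for the radial projections. A boundary point has an integral
  coordinate, hence \<open>codim\<close> at least 1, and this saves one colour.\<close>

lemma colourable_if_holes:
  fixes S :: "(nat \<Rightarrow> int) set"
  assumes n_pos: "0 < n"
    and holes: "\<And>h. \<exists>M. \<forall>q. \<exists>c. (\<forall>i<n. \<bar>q i - c i\<bar> \<le> M) \<and> (\<forall>s\<in>S. \<exists>i<n. h < \<bar>s i - c i\<bar>)"
  shows "colourable n S (n - 1)"
proof (rule colourable_if_approximable)
  fix r :: int
  define r' where "r' = \<bar>r\<bar> + 1"
  \<comment> \<open>With 8 from the Lipschitz bound across cubes and \<open>2 * n + 2\<close> the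
    inverse of the tolerance \<eta>, the projections move \<open>r\<close>-close points by at most
    \<eta>.\<close>
  define h where "h = 8 * (2 * int n + 2) * r'"
  obtain M where M: "\<forall>q. \<exists>c. (\<forall>i<n. \<bar>q i - c i\<bar> \<le> M) \<and> (\<forall>s\<in>S. \<exists>i<n. h < \<bar>s i - c i\<bar>)"
    using holes[of h] by blast
  \<comment> \<open>Cubes of side \<open>6 * M'\<close> have their midpoint at
    \<open>3 * M'\<close>; a hole within \<open>M'\<close> of it is, after rescaling, in the middle
    third. The summand \<open>r'\<close> ensures \<open>r' < R\<close>, so that close points lie in
    the same cube or in cubes sharing a boundary point.\<close>
  define M' where "M' = \<bar>M\<bar> + r' + 1"
  define R where "R = 6 * M'"
  have pos: "0 < r'" "0 < h" "0 < M'" "0 < R" "r' < R"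
    by (auto simp: r'_def h_def M'_def R_def)
  have "\<forall>q. \<exists>c. (\<forall>i<n. \<bar>(q i * R + 3 * M') - c i\<bar> \<le> M') \<and> (\<forall>s\<in>S. \<exists>i<n. h < \<bar>s i - c i\<bar>)"
  proof
    fix q :: "nat \<Rightarrow> int"
    obtain c where c: "\<forall>i<n. \<bar>(q i * R + 3 * M') - c i\<bar> \<le> M" "\<forall>s\<in>S. \<exists>i<n. h < \<bar>s i - c i\<bar>"
      using M[rule_format, of "\<lambda>i. q i * R + 3 * M'"] by blast
    have "M \<le> M'" using pos by (auto simp: M'_def)
    then have "\<forall>i<n. \<bar>(q i * R + 3 * M') - c i\<bar> \<le> M'" using c(1) by fastforce
    with c(2) show "\<exists>c. (\<forall>i<n. \<bar>(q i * R + 3 * M') - c i\<bar> \<le> M') \<and> (\<forall>s\<in>S. \<exists>i<n. h < \<bar>s i - c i\<bar>)"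
      by blast
  qed
  from choice[OF this] obtain c where c1: "\<And>q i. i < n \<Longrightarrow> \<bar>(q i * R + 3 * M') - c q i\<bar> \<le> M'"
    and c2: "\<And>q s. s \<in> S \<Longrightarrow> \<exists>i<n. h < \<bar>s i - c q i\<bar>"
    by blast
  define cen where "cen q i = real_of_int (c q i) / of_int R" for q i
  define cell where "cell = (\<lambda>x i. if i < n then \<lfloor>x i :: real\<rfloor> else 0)"
  define sc where "sc s i = real_of_int (s i) / of_int R" for s :: "nat \<Rightarrow> int" and i :: nat
  define P where "P s = radial n (cell (sc s)) (cen (cell (sc s))) (sc s)" for s
  have mid: "of_int (q i) + 1/3 \<le> cen q i" "cen q i \<le> of_int (q i) + 2/3" if "i < n" for q i
  proof -
    have "\<bar>(q i * R + 3 * M') - c q i\<bar> \<le> M'" using c1[OF that] .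
    then have "real_of_int (3 * (q i * R) + R) \<le> real_of_int (3 * c q i)"
      "real_of_int (3 * c q i) \<le> real_of_int (3 * (q i * R) + 2 * R)"
      unfolding of_int_le_iff R_def by linarith+
    then show "of_int (q i) + 1/3 \<le> cen q i" "cen q i \<le> of_int (q i) + 2/3"
      using pos(4) by (auto simp: cen_def field_simps)
  qed
  have far: "of_int h / of_int R \<le> gauge_cube n q (cen q) (sc s)" if s: "s \<in> S" for s q
  proof -
    obtain i where i: "i < n" "h < \<bar>s i - c q i\<bar>" using c2[OF s, of q] by blast
    have "real_of_int h \<le> \<bar>real_of_int (s i) - of_int (c q i)\<bar>" using i(2) by linarith
    then have "of_int h / of_int R \<le> \<bar>real_of_int (s i) - of_int (c q i)\<bar> / of_int R"
      using pos(4) by (intro divide_right_mono) auto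
    also have "\<dots> = \<bar>sc s i - cen q i\<bar>"
      using pos(4) by (simp add: sc_def cen_def abs_divide flip: diff_divide_distrib)
    also have "\<dots> \<le> gauge_cube n q (cen q) (sc s)"
      using n_pos mid i(1) by (intro gauge_cube_ge_abs) auto
    finally show ?thesis .
  qed
  have hR: "0 < real_of_int h / of_int R" using pos by simp
  have gpos: "0 < gauge_cube n q (cen q) (sc s)" if "s \<in> S" for s q
    using far[OF that, of q] hR by linarith
  show "\<exists>R P. 0 < R \<and> (\<forall>x\<in>S. \<forall>i<n. \<bar>P x i - real_of_int (x i) / real_of_int R\<bar> \<le> 1) \<and>
     (\<forall>x\<in>S. \<forall>y\<in>S. (\<forall>i<n. \<bar>x i - y i\<bar> \<le> r) \<longrightarrow> (\<forall>i<n. \<bar>P x i - P y i\<bar> \<le> 1 / (2 * real n + 2))) \<and>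
     (\<forall>x\<in>S. 1 \<le> codim n (1 / (2 * real n + 2)) (P x))"
  proof (intro exI conjI ballI allI impI)
    show "0 < R" by fact
  next
    fix x i assume x: "x \<in> S" "i < n"
    have "of_int (cell (sc x) i) \<le> P x i" "P x i \<le> of_int (cell (sc x) i) + 1"
      unfolding P_def using n_pos mid gpos[OF x(1)] x(2) by (intro radial_in_cube; blast)+
    moreover have "of_int (cell (sc x) i) \<le> sc x i" "sc x i \<le> of_int (cell (sc x) i) + 1"
      using x(2) by (auto simp: cell_def)
    ultimately have "\<bar>P x i - sc x i\<bar> \<le> 1" by linarith
    then show "\<bar>P x i - real_of_int (x i) / real_of_int R\<bar> \<le> 1" by (simp add: sc_def)
  next
    fix x y i assume xy: "x \<in> S" "y \<in> S" "\<forall>i<n. \<bar>x i - y i\<bar> \<le> r" "i < n"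
    have near: "\<bar>sc x i - sc y i\<bar> \<le> of_int r' / of_int R" if "i < n" for i
    proof -
      have "\<bar>x i - y i\<bar> \<le> r" using xy(3) that by blast
      then have "\<bar>real_of_int (x i) - of_int (y i)\<bar> \<le> of_int r'" unfolding r'_def by linarith
      then have "\<bar>real_of_int (x i) - of_int (y i)\<bar> / of_int R \<le> of_int r' / of_int R"
        using pos(4) by (intro divide_right_mono) auto
      then show ?thesis
        using pos(4) by (simp add: sc_def abs_divide flip: diff_divide_distrib)
    qed
    have "\<bar>P x i - P y i\<bar> \<le> 8 * (of_int r' / of_int R) / (of_int h / of_int R)"
      unfolding P_def cell_def
      by (rule radial_lipschitz_across_cubes[where cen = cen, OF n_pos])
        (use pos hR xy in \<open>auto intro: mid near far\<close>)
    also have "\<dots> = 1 / (2 * real n + 2)"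
    proof -
      have "real_of_int h = 8 * (2 * real n + 2) * of_int r'" by (simp add: h_def)
      then have "8 * of_int r' / of_int h = 1 / (2 * real n + 2)"
        using pos by (simp add: frac_eq_eq)
      then show ?thesis using pos by simp
    qed
    finally show "\<bar>P x i - P y i\<bar> \<le> 1 / (2 * real n + 2)" .
  next
    fix x assume x: "x \<in> S"
    have "\<exists>i<n. P x i \<in> \<int>"
      unfolding P_def using n_pos mid gpos[OF x] by (intro radial_integral_coordinate) auto
    then obtain i where "i < n" "P x i \<in> \<int>" by blast
    then show "1 \<le> codim n (1 / (2 * real n + 2)) (P x)"
      by (rule codim_pos) auto
  qed
qed

section \<open>Integer combinations and generated subgroups\<close>

text \<open>At most one of the two iterates is nontrivial, so a single formula serves both
  signs.\<close>

definition zmul :: "int \<Rightarrow> 'a::ab_group_add \<Rightarrow> 'a" where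
  "zmul k x = ((+) x ^^ nat k) 0 - ((+) x ^^ nat (- k)) 0"

lemma zmul_0 [simp]: "zmul 0 x = 0"
  by (simp add: zmul_def)

lemma zmul_succ: "zmul (k + 1) x = zmul k x + x"
proof (cases "0 \<le> k")
  case True
  then have "nat (k + 1) = Suc (nat k)" by simp
  with True show ?thesis by (simp add: zmul_def)
next
  case False
  then have "nat (- k) = Suc (nat (- (k + 1)))" by simp
  with False show ?thesis by (simp add: zmul_def)
qed

lemma zmul_pred: "zmul (k - 1) x = zmul k x - x"
  using zmul_succ[of "k - 1" x] by simp

lemma zmul_1 [simp]: "zmul 1 x = x"
  using zmul_succ[of 0 x] by simp

lemma zmul_add: "zmul (j + k) x = zmul j x + zmul k x"
proof (induction k rule: int_induct[where k = 0])
  case (step1 k)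
  then show ?case using zmul_succ[of "j + k" x] by (simp add: zmul_succ add.assoc)
next
  case (step2 k)
  then show ?case using zmul_pred[of "j + k" x] by (simp add: zmul_pred add_diff_eq)
qed simp

lemma zmul_minus: "zmul (- k) x = - zmul k x"
  using zmul_add[of "- k" k x] by (simp add: eq_neg_iff_add_eq_0)

lemma zmul_diff: "zmul (j - k) x = zmul j x - zmul k x"
  using zmul_add[of j "- k" x] by (simp add: zmul_minus)

lemma zmul_zero_right [simp]: "zmul k 0 = 0"
  by (induction k rule: int_induct[where k = 0]) (auto simp: zmul_succ zmul_pred)

lemma zmul_add_right: "zmul k (x + y) = zmul k x + zmul k y"
  by (induction k rule: int_induct[where k = 0]) (auto simp: zmul_succ zmul_pred)

lemma zmul_zmul: "zmul j (zmul k x) = zmul (j * k) x"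
  by (induction j rule: int_induct[where k = 0])
    (auto simp: zmul_succ zmul_pred zmul_add zmul_diff algebra_simps)

text \<open>Elements of \<int>^n are total functions whose values from \<open>n\<close> on are
  ignored; hence all bounds on coefficients are restricted to \<open>i < n\<close>.\<close>

definition lat :: "nat \<Rightarrow> (nat \<Rightarrow> 'a::ab_group_add) \<Rightarrow> (nat \<Rightarrow> int) \<Rightarrow> 'a" where
  "lat n y c = (\<Sum>i<n. zmul (c i) (y i))"

lemma lat_0 [simp]: "lat 0 y c = 0"
  by (simp add: lat_def)

lemma lat_Suc: "lat (Suc n) y c = lat n y c + zmul (c n) (y n)"
  by (simp add: lat_def)

lemma lat_Suc_shift: "lat (Suc m) y c = zmul (c 0) (y 0) + lat m (y \<circ> Suc) (c \<circ> Suc)"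
  unfolding lat_def by (subst sum.lessThan_Suc_shift) simp

lemma lat_zero [simp]: "lat n y (\<lambda>_. 0) = 0"
  by (simp add: lat_def)

lemma lat_add: "lat n y (\<lambda>i. c i + d i) = lat n y c + lat n y d"
  by (simp add: lat_def zmul_add sum.distrib)

lemma lat_diff: "lat n y (\<lambda>i. c i - d i) = lat n y c - lat n y d"
  by (simp add: lat_def zmul_diff sum_subtractf)

lemma lat_minus: "lat n y (\<lambda>i. - c i) = - lat n y c"
  by (simp add: lat_def zmul_minus sum_negf)

lemma zmul_lat: "zmul k (lat n y c) = lat n y (\<lambda>i. k * c i)"
  by (induction n) (auto simp: lat_Suc zmul_add_right zmul_zmul)

lemma lat_cong:
  "(\<And>i. i < n \<Longrightarrow> c i = d i) \<Longrightarrow> (\<And>i. i < n \<Longrightarrow> y i = z i) \<Longrightarrow> lat n y c = lat n z d"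
  unfolding lat_def by (rule sum.cong) auto

lemma lat_extend:
  assumes "n \<le> m" "\<And>i. i < n \<Longrightarrow> y' i = y i"
  shows "lat m y' (\<lambda>i. if i < n then c i else 0) = lat n y c"
  using assms(1)
proof (induction m)
  case 0
  then show ?case by simp
next
  case (Suc m)
  show ?case
  proof (cases "n = Suc m")
    case True
    show ?thesis unfolding True using assms(2) True by (intro lat_cong) auto
  next
    case False
    then show ?thesis using Suc by (simp add: lat_Suc)
  qed
qed

definition is_subgroup :: "'a::ab_group_add set \<Rightarrow> bool" where
  "is_subgroup H \<longleftrightarrow> 0 \<in> H \<and> (\<forall>x\<in>H. \<forall>y\<in>H. x + y \<in> H) \<and> (\<forall>x\<in>H. - x \<in> H)"

lemma is_subgroupD:
  assumes "is_subgroup H"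
  shows "0 \<in> H" "x \<in> H \<Longrightarrow> y \<in> H \<Longrightarrow> x + y \<in> H" "x \<in> H \<Longrightarrow> - x \<in> H"
    "x \<in> H \<Longrightarrow> y \<in> H \<Longrightarrow> x - y \<in> H"
proof -
  show 1: "0 \<in> H" "x \<in> H \<Longrightarrow> y \<in> H \<Longrightarrow> x + y \<in> H" "x \<in> H \<Longrightarrow> - x \<in> H" for x y
    using assms by (auto simp: is_subgroup_def)
  show "x \<in> H \<Longrightarrow> y \<in> H \<Longrightarrow> x - y \<in> H" using 1(2)[of x "- y"] 1(3)[of y] by simp
qed

lemma is_subgroup_zmul: "is_subgroup H \<Longrightarrow> x \<in> H \<Longrightarrow> zmul k x \<in> H"
  by (induction k rule: int_induct[where k = 0]) (auto simp: zmul_succ zmul_pred is_subgroupD)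

lemma is_subgroup_lat:
  assumes "is_subgroup H" "\<And>i. i < n \<Longrightarrow> y i \<in> H"
  shows "lat n y c \<in> H"
  using assms(2) by (induction n) (auto simp: lat_Suc intro!: is_subgroupD[OF assms(1)] is_subgroup_zmul[OF assms(1)])

lemma is_subgroup_range_lat: "is_subgroup (range (lat n y))"
  unfolding is_subgroup_def
proof (intro conjI ballI)
  show "0 \<in> range (lat n y)" by (rule range_eqI[of _ _ "\<lambda>_. 0"]) simp
  show "a + b \<in> range (lat n y)" if "a \<in> range (lat n y)" "b \<in> range (lat n y)" for a b
    using that by (auto simp flip: lat_add)
  show "- a \<in> range (lat n y)" if "a \<in> range (lat n y)" for a
    using that by (auto simp flip: lat_minus)
qed

lemma gen_subgroup_alt: "gen_subgroup K = \<Inter>{H. K \<subseteq> H \<and> is_subgroup H}"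
  by (simp add: gen_subgroup_def is_subgroup_def)

lemma is_subgroup_gen: "is_subgroup (gen_subgroup K)"
  unfolding gen_subgroup_alt by (auto simp: is_subgroup_def)

lemma gen_subgroup_superset: "K \<subseteq> gen_subgroup K"
  unfolding gen_subgroup_alt by auto

lemma gen_subgroup_least: "K \<subseteq> H \<Longrightarrow> is_subgroup H \<Longrightarrow> gen_subgroup K \<subseteq> H"
  unfolding gen_subgroup_alt by auto

lemma gen_subgroup_insert: "gen_subgroup (insert z F) \<subseteq> {zmul k z + x |k x. x \<in> gen_subgroup F}"
proof (rule gen_subgroup_least)
  note G = is_subgroupD[OF is_subgroup_gen[of F]]
  have "z = zmul 1 z + 0" "f = zmul 0 z + f" for f by simp_all
  then show "insert z F \<subseteq> {zmul k z + x |k x. x \<in> gen_subgroup F}"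
    using G(1) gen_subgroup_superset[of F] by blast
  show "is_subgroup {zmul k z + x |k x. x \<in> gen_subgroup F}"
    unfolding is_subgroup_def
  proof (intro conjI ballI)
    have "0 = zmul 0 z + 0" by simp
    then show "0 \<in> {zmul k z + x |k x. x \<in> gen_subgroup F}" using G(1) by blast
  next
    fix a b assume "a \<in> {zmul k z + x |k x. x \<in> gen_subgroup F}" "b \<in> {zmul k z + x |k x. x \<in> gen_subgroup F}"
    then obtain j k x x' where *: "a = zmul j z + x" "b = zmul k z + x'" "x \<in> gen_subgroup F" "x' \<in> gen_subgroup F"
      by blast
    have "a + b = zmul (j + k) z + (x + x')" using * by (simp add: zmul_add)
    then show "a + b \<in> {zmul k z + x |k x. x \<in> gen_subgroup F}" using * G(2) by blast
  next
    fix a assume "a \<in> {zmul k z + x |k x. x \<in> gen_subgroup F}"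
    then obtain j x where *: "a = zmul j z + x" "x \<in> gen_subgroup F" by blast
    have "- a = zmul (- j) z + (- x)" using * by (simp add: zmul_minus)
    then show "- a \<in> {zmul k z + x |k x. x \<in> gen_subgroup F}" using * G(3) by blast
  qed
qed

section \<open>Proper lattices in locally compact abelian groups\<close>

text \<open>Closure under subsets allows error sets such as sums and boxes to be used without
  checking that they are themselves compact.\<close>

definition rel_compact :: "'a::topological_space set \<Rightarrow> bool" where
  "rel_compact B \<longleftrightarrow> (\<exists>K. compact K \<and> B \<subseteq> K)"

lemma rel_compact_subset: "rel_compact B \<Longrightarrow> A \<subseteq> B \<Longrightarrow> rel_compact A"
  unfolding rel_compact_def by blast

lemma rel_compact_Un: "rel_compact A \<Longrightarrow> rel_compact B \<Longrightarrow> rel_compact (A \<union> B)"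
  unfolding rel_compact_def by (meson compact_Un Un_mono)

lemma rel_compact_finite: "finite A \<Longrightarrow> rel_compact A"
  unfolding rel_compact_def by (meson finite_imp_compact order_refl)

lemma mem_plus: "a \<in> A \<Longrightarrow> b \<in> B \<Longrightarrow> u = a + b \<Longrightarrow> u \<in> A + B"
  by (simp add: set_plus_intro)

lemma mem_minus: "a \<in> A \<Longrightarrow> b \<in> B \<Longrightarrow> u = a - b \<Longrightarrow> u \<in> A + uminus ` B"
  for a :: "'a::ab_group_add"
  by (rule mem_plus[of a A "- b"]) auto

locale lca_group =
  fixes T :: "'a::{ab_group_add, t2_space} itself"
  assumes add_cont: "continuous_on UNIV (\<lambda>p::'a \<times> 'a. fst p + snd p)"
    and neg_cont: "continuous_on UNIV (\<lambda>x::'a. - x)"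
    and loc_compact: "locally_compact_space (euclidean :: 'a topology)"
begin

lemma continuous_plus:
  fixes f g :: "'b::topological_space \<Rightarrow> 'a"
  assumes "continuous_on S f" "continuous_on S g"
  shows "continuous_on S (\<lambda>x. f x + g x)"
  using continuous_on_compose2[OF add_cont continuous_on_Pair[OF assms]] by simp

lemma continuous_minus:
  fixes f g :: "'b::topological_space \<Rightarrow> 'a"
  assumes "continuous_on S f" "continuous_on S g"
  shows "continuous_on S (\<lambda>x. f x - g x)"
  using continuous_plus[OF assms(1) continuous_on_compose2[OF neg_cont assms(2)]] by simp

lemma rel_compact_plus:
  fixes A B :: "'a set"
  assumes "rel_compact A" "rel_compact B"
  shows "rel_compact (A + B)"
proof -
  obtain K L where *: "compact K" "compact L" "A \<subseteq> K" "B \<subseteq> L"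
    using assms unfolding rel_compact_def by blast
  have "compact ((\<lambda>p. fst p + snd p) ` (K \<times> L))"
    by (intro compact_continuous_image compact_Times * continuous_on_subset[OF add_cont]) auto
  moreover have "A + B \<subseteq> (\<lambda>p. fst p + snd p) ` (K \<times> L)"
    using * by (fastforce simp: set_plus_def image_iff)
  ultimately show ?thesis unfolding rel_compact_def by blast
qed

lemma rel_compact_uminus:
  fixes A :: "'a set"
  assumes "rel_compact A"
  shows "rel_compact (uminus ` A)"
  using assms unfolding rel_compact_def
  by (meson compact_continuous_image continuous_on_subset[OF neg_cont] image_mono subset_UNIV)

lemma rel_compact_minus:
  fixes A B :: "'a set"
  shows "rel_compact A \<Longrightarrow> rel_compact B \<Longrightarrow> rel_compact (A + uminus ` B)"
  by (intro rel_compact_plus rel_compact_uminus)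

lemma rel_compact_cover:
  fixes U B :: "'a set"
  assumes "rel_compact B" "open U" "0 \<in> U"
  obtains F where "finite F" "\<And>b. b \<in> B \<Longrightarrow> \<exists>f\<in>F. b - f \<in> U"
proof -
  obtain K where K: "compact K" "B \<subseteq> K" using assms unfolding rel_compact_def by blast
  have "open {x. x - f \<in> U}" for f
    using open_vimage[OF assms(2) continuous_minus[OF continuous_on_id continuous_on_const[of _ f]]]
    by (simp add: vimage_def)
  moreover have "K \<subseteq> (\<Union>f\<in>K. {x. x - f \<in> U})" using assms(3) by auto
  ultimately obtain F where "F \<subseteq> K" "finite F" "K \<subseteq> (\<Union>f\<in>F. {x. x - f \<in> U})"
    using compactE_image[OF K(1), of K "\<lambda>f. {x. x - f \<in> U}"] by metis
  then show thesis using that[of F] K(2) by blast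
qed

text \<open>The fourfold difference is what arises when two points of one translate of
  \<open>U\<close> are subtracted and a return to \<open>U - U\<close> is subtracted from the
  result.\<close>

lemma small_neighbourhood:
  obtains U V :: "'a set" where "open U" "0 \<in> U" "rel_compact V"
    "\<And>a b c d. a \<in> U \<Longrightarrow> b \<in> U \<Longrightarrow> c \<in> U \<Longrightarrow> d \<in> U \<Longrightarrow> (a - b) - (c - d) \<in> V"
proof -
  obtain V0 V :: "'a set" where V: "open V0" "compact V" "0 \<in> V0" "V0 \<subseteq> V"
  proof -
    have "\<exists>U K. open U \<and> compact K \<and> (0::'a) \<in> U \<and> U \<subseteq> K"
      using loc_compact unfolding locally_compact_space_def by (auto simp flip: open_openin)
    then show ?thesis using that by blast
  qed
  define f where "f = (\<lambda>((a, b), (c, d)). (a - b) - (c - d) :: 'a)"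
  have f: "f = (\<lambda>p. (fst (fst p) - snd (fst p)) - (fst (snd p) - snd (snd p)))"
    by (auto simp: f_def fun_eq_iff)
  have "continuous_on UNIV f"
    unfolding f by (intro continuous_minus continuous_on_fst continuous_on_snd continuous_on_id)
  then have "open (f -` V0)" using V(1) by (rule open_vimage[rotated])
  moreover have "((0, 0), (0, 0)) \<in> f -` V0" using V(3) by (simp add: f_def)
  ultimately obtain A B where AB: "open A" "open B" "(0, 0) \<in> A" "(0, 0) \<in> B" "A \<times> B \<subseteq> f -` V0"
    by (rule open_prod_elim) (metis mem_Sigma_iff)
  obtain A1 A2 where A: "open A1" "open A2" "0 \<in> A1" "0 \<in> A2" "A1 \<times> A2 \<subseteq> A"
    using AB(1,3) by (auto elim!: open_prod_elim)
  obtain B1 B2 where B: "open B1" "open B2" "0 \<in> B1" "0 \<in> B2" "B1 \<times> B2 \<subseteq> B"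
    using AB(2,4) by (auto elim!: open_prod_elim)
  show thesis
  proof (rule that[of "A1 \<inter> A2 \<inter> B1 \<inter> B2" V])
    show "rel_compact V" using V unfolding rel_compact_def by blast
    fix a b c d assume "a \<in> A1 \<inter> A2 \<inter> B1 \<inter> B2" "b \<in> A1 \<inter> A2 \<inter> B1 \<inter> B2"
      "c \<in> A1 \<inter> A2 \<inter> B1 \<inter> B2" "d \<in> A1 \<inter> A2 \<inter> B1 \<inter> B2"
    then have "((a, b), (c, d)) \<in> A \<times> B" using A B by blast
    then have "((a, b), (c, d)) \<in> f -` V0" using AB(5) by blast
    then show "(a - b) - (c - d) \<in> V" using V(4) by (auto simp: f_def)
  qed (use A B in auto)
qed

lemma rel_compact_box: "rel_compact {lat n y c |c. \<forall>i<n. \<bar>c i\<bar> \<le> M}" for y :: "nat \<Rightarrow> 'a"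
proof (induction n)
  case 0
  show ?case by (rule rel_compact_finite) simp
next
  case (Suc n)
  have "{lat (Suc n) y c |c. \<forall>i<Suc n. \<bar>c i\<bar> \<le> M}
      \<subseteq> {lat n y c |c. \<forall>i<n. \<bar>c i\<bar> \<le> M} + (\<lambda>k. zmul k (y n)) ` {-M..M}"
  proof clarify
    fix c :: "nat \<Rightarrow> int" assume c: "\<forall>i<Suc n. \<bar>c i\<bar> \<le> M"
    then have "c n \<in> {-M..M}" by (auto simp: abs_le_iff)
    then show "lat (Suc n) y c \<in> {lat n y c |c. \<forall>i<n. \<bar>c i\<bar> \<le> M} + (\<lambda>k. zmul k (y n)) ` {-M..M}"
      unfolding lat_Suc using c by (intro set_plus_intro) auto
  qed
  then show ?case
    by (rule rel_compact_subset[rotated]) (intro rel_compact_plus Suc rel_compact_finite, simp)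
qed

section \<open>Extending proper lattices by further group elements\<close>

text \<open>Taking \<open>B = {0}\<close> gives injectivity on \<int>^n, because the multiples of a
  kernel element would be unbounded; general \<open>B\<close> gives a discrete image.\<close>

definition proper_lat :: "nat \<Rightarrow> (nat \<Rightarrow> 'a) \<Rightarrow> bool" where
  "proper_lat n y \<longleftrightarrow>
     (\<forall>B. rel_compact B \<longrightarrow> (\<exists>M. \<forall>c. lat n y c \<in> B \<longrightarrow> (\<forall>i<n. \<bar>c i\<bar> \<le> M)))"

lemma proper_latD:
  assumes "proper_lat n y" "rel_compact B"
  obtains M where "\<And>c i. lat n y c \<in> B \<Longrightarrow> i < n \<Longrightarrow> \<bar>c i\<bar> \<le> M"
  using assms unfolding proper_lat_def by blast

lemma proper_lat_0: "proper_lat 0 y"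
  by (simp add: proper_lat_def)

lemma proper_lat_prefix:
  assumes "proper_lat m y'" "n \<le> m" "\<And>i. i < n \<Longrightarrow> y' i = y i"
  shows "proper_lat n y"
  unfolding proper_lat_def
proof (intro allI impI)
  fix B :: "'a set" assume "rel_compact B"
  then obtain M where M: "\<And>c i. lat m y' c \<in> B \<Longrightarrow> i < m \<Longrightarrow> \<bar>c i\<bar> \<le> M"
    using proper_latD[OF assms(1)] by blast
  have "\<bar>c i\<bar> \<le> M" if "lat n y c \<in> B" "i < n" for c i
    using M[of "\<lambda>i. if i < n then c i else 0" i] that assms(2)
      lat_extend[of n m y' y c, OF assms(2,3)] by auto
  then show "\<exists>M. \<forall>c. lat n y c \<in> B \<longrightarrow> (\<forall>i<n. \<bar>c i\<bar> \<le> M)" by blast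
qed

text \<open>A relative form of Weil's lemma on monothetic groups: modulo a discrete lattice, a cyclic
  group is either discrete or relatively compact. If it is not discrete, multiples of \<open>z\<close> return to
  a fixed compact neighbourhood \<open>V\<close>, and by compactness of \<open>V\<close> they do so with bounded gaps.\<close>

lemma proper_lat_extend_or_bounded:
  assumes proper: "proper_lat n y" and not_proper: "\<not> proper_lat (Suc n) (y(n := z))"
  shows "\<exists>B. rel_compact B \<and> (\<forall>k. \<exists>c. zmul k z - lat n y c \<in> B)"
proof -
  define L where "L = range (lat n y)"
  note L = is_subgroupD[OF is_subgroup_range_lat[of n y], folded L_def]
  obtain U V :: "'a set" where UV: "open U" "0 \<in> U" "rel_compact V"
    "\<And>a b c d. a \<in> U \<Longrightarrow> b \<in> U \<Longrightarrow> c \<in> U \<Longrightarrow> d \<in> U \<Longrightarrow> (a - b) - (c - d) \<in> V"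
    using small_neighbourhood by blast
  have lat_z: "lat (Suc n) (y(n := z)) c = lat n y c + zmul (c n) z" for c
    by (simp add: lat_Suc) (rule lat_cong, auto)
  obtain B where B: "rel_compact B"
    and unb: "\<And>M. \<exists>c. lat n y c + zmul (c n) z \<in> B \<and> (\<exists>i<Suc n. M < \<bar>c i\<bar>)"
    using not_proper unfolding proper_lat_def lat_z by (auto simp: not_le)
  \<comment> \<open>Unboundedness must occur in the new coefficient: if that one were bounded, the
    remaining part would lie in a relatively compact set and properness of \<open>y\<close> would
    bound the others.\<close>
  have unb_n: "\<exists>c. lat n y c + zmul (c n) z \<in> B \<and> M < \<bar>c n\<bar>" for M
  proof (rule ccontr)
    assume "\<not> ?thesis"
    then have M: "\<bar>c n\<bar> \<le> M" if "lat n y c + zmul (c n) z \<in> B" for c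
      using that by (meson not_le)
    have "rel_compact (B + uminus ` (\<lambda>k. zmul k z) ` {-M..M})"
      by (intro rel_compact_minus B rel_compact_finite) simp
    then obtain M' where M': "\<And>c i. lat n y c \<in> B + uminus ` (\<lambda>k. zmul k z) ` {-M..M} \<Longrightarrow> i < n \<Longrightarrow> \<bar>c i\<bar> \<le> M'"
      using proper_latD[OF proper] by blast
    obtain c i where c: "lat n y c + zmul (c n) z \<in> B" "i < Suc n" "max M M' < \<bar>c i\<bar>"
      using unb by blast
    have "c n \<in> {-M..M}" using M[OF c(1)] by (auto simp: abs_le_iff)
    then have "lat n y c \<in> B + uminus ` (\<lambda>k. zmul k z) ` {-M..M}"
      using c(1) by (intro mem_minus[OF c(1) imageI]) auto
    then have "i \<noteq> n \<Longrightarrow> \<bar>c i\<bar> \<le> M'" using M' c(2) by auto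
    then show False using c(3) M[OF c(1)] by (cases "i = n") auto
  qed
  define B' where "B' = B \<union> uminus ` B"
  have ret_B: "\<exists>k>M. \<exists>l\<in>L. zmul k z - l \<in> B'" for M
  proof -
    obtain c where c: "lat n y c + zmul (c n) z \<in> B" "\<bar>M\<bar> < \<bar>c n\<bar>" using unb_n by blast
    have l: "lat n y c \<in> L" by (simp add: L_def)
    show ?thesis
    proof (cases "0 \<le> c n")
      case True
      then show ?thesis
        using c L(3)[OF l] by (intro exI[of _ "c n"] conjI bexI[of _ "- lat n y c"])
          (auto simp: B'_def add.commute)
    next
      case False
      have "- (zmul (c n) z + lat n y c) \<in> B'"
        unfolding B'_def using c(1) by (metis UnI2 add.commute imageI)
      then have "zmul (- c n) z - lat n y c \<in> B'" by (simp add: zmul_minus)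
      then show ?thesis using False c(2) l by (intro exI[of _ "- c n"] conjI bexI[of _ "lat n y c"]) auto
    qed
  qed
  \<comment> \<open>Infinitely many returns to \<open>B'\<close> fall into the same translate of
    \<open>U\<close>. Subtracting a fixed one from later ones gives arbitrarily late returns to
    \<open>U - U\<close>.\<close>
  have ret_U: "\<exists>k>M. \<exists>l\<in>L. \<exists>a\<in>U. \<exists>b\<in>U. zmul k z - l = a - b" for M
  proof -
    obtain F where F: "finite F" "\<And>b. b \<in> B' \<Longrightarrow> \<exists>f\<in>F. b - f \<in> U"
      using rel_compact_cover[of B' U] UV B by (auto simp: B'_def rel_compact_Un rel_compact_uminus)
    define A where "A = {k. 0 < k \<and> (\<exists>l\<in>L. zmul k z - l \<in> B')}"
    have inf: "\<exists>k\<in>C. M < k" if "infinite C" "C \<subseteq> A" for C M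
    proof (rule ccontr)
      assume "\<not> ?thesis"
      then have "C \<subseteq> {0..M}" using that(2) by (auto simp: A_def not_less)
      then show False using that(1) finite_subset by blast
    qed
    have "infinite A"
    proof
      assume fin: "finite A"
      obtain k where k: "k > max 0 (Max A)" "\<exists>l\<in>L. zmul k z - l \<in> B'" using ret_B by blast
      then have "k \<in> A" by (auto simp: A_def)
      then show False using Max_ge[OF fin] k(1) by fastforce
    qed
    have "\<forall>k\<in>A. \<exists>f. f \<in> F \<and> (\<exists>l\<in>L. zmul k z - l - f \<in> U)"
      using F(2) by (fastforce simp: A_def)
    from bchoice[OF this] obtain f where f: "\<And>k. k \<in> A \<Longrightarrow> f k \<in> F"
      "\<And>k. k \<in> A \<Longrightarrow> \<exists>l\<in>L. zmul k z - l - f k \<in> U" by blast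
    have "finite (f ` A)" using f(1) F(1) by (meson finite_subset image_subsetI)
    then obtain k0 where k0: "k0 \<in> A" "infinite {k \<in> A. f k = f k0}"
      using pigeonhole_infinite[OF \<open>infinite A\<close>] by blast
    obtain k where k: "k \<in> A" "f k = f k0" "M + k0 < k" using inf[OF k0(2), of "M + k0"] by auto
    obtain l l0 where l: "l \<in> L" "l0 \<in> L" "zmul k z - l - f k0 \<in> U" "zmul k0 z - l0 - f k0 \<in> U"
      using f(2)[OF k(1)] f(2)[OF k0(1)] k(2) by auto
    have "zmul (k - k0) z - (l - l0) = (zmul k z - l - f k0) - (zmul k0 z - l0 - f k0)"
      by (simp add: zmul_diff)
    moreover have "M < k - k0" using k(3) by simp
    ultimately show ?thesis using l L(4)[OF l(1,2)] by blast
  qed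
  define Q where "Q k \<longleftrightarrow> (\<exists>l\<in>L. zmul k z - l \<in> V)" for k
  have UV': "a - b \<in> V" if "a \<in> U" "b \<in> U" for a b using UV(4)[OF that UV(2) UV(2)] by simp
  have ret_V: "\<exists>k>M. Q k" for M
    using ret_U[of M] UV' unfolding Q_def by metis
  obtain F where F: "finite F" "\<And>b. b \<in> V \<Longrightarrow> \<exists>f\<in>F. b - f \<in> U"
    using rel_compact_cover[of V U] UV by blast
  define G where "G = {f \<in> F. \<exists>k. \<exists>l\<in>L. zmul k z - l - f \<in> U}"
  have "\<forall>f\<in>G. \<exists>k. \<exists>l\<in>L. zmul k z - l - f \<in> U" by (auto simp: G_def)
  from bchoice[OF this] obtain k1 where k1: "\<And>f. f \<in> G \<Longrightarrow> \<exists>l\<in>L. zmul (k1 f) z - l - f \<in> U" by blast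
  \<comment> \<open>The return \<open>k1 f\<close> may be negative; a return to \<open>U - U\<close>
    later than its absolute value makes the total backward step \<open>k1 f + k2 f\<close> at least
    1.\<close>
  have "\<forall>f. \<exists>k>\<bar>k1 f\<bar>. \<exists>l\<in>L. \<exists>a\<in>U. \<exists>b\<in>U. zmul k z - l = a - b" using ret_U by blast
  from choice[OF this] obtain k2 where k2: "\<And>f. \<bar>k1 f\<bar> < k2 f"
    "\<And>f. \<exists>l\<in>L. \<exists>a\<in>U. \<exists>b\<in>U. zmul (k2 f) z - l = a - b" by blast
  define N where "N = Max (insert 0 ((\<lambda>f. k1 f + k2 f) ` G))"
  have finG: "finite G" using F(1) by (simp add: G_def)
  \<comment> \<open>The return at \<open>k\<close> and the return at \<open>k1 f\<close> lie in the
    same translate \<open>f + U\<close> modulo the lattice. Their difference, corrected by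
    \<open>k2 f\<close>, is again in \<open>V\<close>, and finitely many \<open>f\<close> leave
    finitely many step lengths.\<close>
  have step: "\<exists>e. 1 \<le> e \<and> e \<le> N \<and> Q (k - e)" if "Q k" for k
  proof -
    obtain l where l: "l \<in> L" "zmul k z - l \<in> V" using \<open>Q k\<close> by (auto simp: Q_def)
    obtain f where f: "f \<in> F" "zmul k z - l - f \<in> U" using F(2)[OF l(2)] by blast
    have "f \<in> G" using f l by (auto simp: G_def)
    obtain l1 where l1: "l1 \<in> L" "zmul (k1 f) z - l1 - f \<in> U" using k1[OF \<open>f \<in> G\<close>] by blast
    obtain l2 a b where l2: "l2 \<in> L" "a \<in> U" "b \<in> U" "zmul (k2 f) z - l2 = a - b" using k2(2)[of f] by blast
    have "zmul (k - (k1 f + k2 f)) z - (l - l1 - l2)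
        = ((zmul k z - l - f) - (zmul (k1 f) z - l1 - f)) - (zmul (k2 f) z - l2)"
      by (simp add: zmul_diff zmul_add)
    also have "\<dots> \<in> V" unfolding l2(4) by (intro UV(4) f l1 l2)
    finally have "Q (k - (k1 f + k2 f))" unfolding Q_def using l l1 l2 L(4) by blast
    moreover have "1 \<le> k1 f + k2 f" using k2(1)[of f] by linarith
    moreover have "k1 f + k2 f \<le> N" unfolding N_def using finG \<open>f \<in> G\<close> by (intro Max_ge) auto
    ultimately show ?thesis by blast
  qed
  \<comment> \<open>The first return from \<open>j\<close> on comes within \<open>N\<close>;
    otherwise a backward step from it would give an earlier return that is still not before
    \<open>j\<close>.\<close>
  have "\<exists>e\<in>{0..N}. Q (j + e)" for j
  proof -
    obtain k where k: "j < k" "Q k" using ret_V by blast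
    define d where "d = (LEAST d. Q (j + int d))"
    have "Q (j + int (nat (k - j)))" using k by simp
    then have d: "Q (j + int d)" unfolding d_def by (rule LeastI)
    obtain e where e: "1 \<le> e" "e \<le> N" "Q (j + int d - e)" using step[OF d] by blast
    have "int d \<le> N"
    proof (rule ccontr)
      assume "\<not> ?thesis"
      then have "int (d - nat e) = int d - e" using e by auto
      then have "j + int (d - nat e) = j + int d - e" by linarith
      then have "Q (j + int (d - nat e))" using e(3) by metis
      then have "d \<le> d - nat e" unfolding d_def by (rule Least_le)
      then show False using e \<open>\<not> int d \<le> N\<close> by linarith
    qed
    then show ?thesis using d by (intro bexI[of _ "int d"]) auto
  qed
  then have "\<exists>c. zmul j z - lat n y c \<in> V + uminus ` (\<lambda>k. zmul k z) ` {0..N}" for j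
  proof -
    obtain e c where e: "e \<in> {0..N}" "zmul (j + e) z - lat n y c \<in> V"
      using \<open>\<And>j. \<exists>e\<in>{0..N}. Q (j + e)\<close>[of j] by (auto simp: Q_def L_def)
    show ?thesis using e by (intro exI mem_minus[OF e(2) imageI]) (auto simp: zmul_add)
  qed
  then show ?thesis
    by (intro exI[of _ "V + uminus ` (\<lambda>k. zmul k z) ` {0..N}"] conjI allI rel_compact_minus UV rel_compact_finite) auto
qed

text \<open>Each generator either becomes a new basis element or is absorbed into the error set. The
  given lattice survives as an initial segment, which is what makes the result applicable to maximal
  lattices and to infinite sequences.\<close>

lemma gen_subgroup_finite_rank:
  fixes y :: "nat \<Rightarrow> 'a"
  assumes "finite F" "proper_lat n y"
  shows "\<exists>n' y' B. n \<le> n' \<and> (\<forall>i<n. y' i = y i) \<and> proper_lat n' y' \<and> rel_compact B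
    \<and> (\<forall>x\<in>gen_subgroup F. \<exists>c. x - lat n' y' c \<in> B)"
  using assms(1)
proof induction
  case empty
  have "gen_subgroup {} \<subseteq> {0::'a}" by (rule gen_subgroup_least) (auto simp: is_subgroup_def)
  then have "\<forall>x\<in>gen_subgroup {}. \<exists>c. x - lat n y c \<in> {0}"
    by (auto intro!: exI[of _ "\<lambda>_. 0"])
  then show ?case using assms(2) rel_compact_finite[of "{0}"] by blast
next
  case (insert z F)
  then obtain n' y' B where IH: "n \<le> n'" "\<forall>i<n. y' i = y i" "proper_lat n' y'" "rel_compact B"
    "\<And>x. x \<in> gen_subgroup F \<Longrightarrow> \<exists>c. x - lat n' y' c \<in> B" by blast
  show ?case
  proof (cases "proper_lat (Suc n') (y'(n' := z))")
    case True
    have "\<exists>c. x - lat (Suc n') (y'(n' := z)) c \<in> B" if x: "x \<in> gen_subgroup (insert z F)" for x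
    proof -
      obtain k u where ku: "x = zmul k z + u" "u \<in> gen_subgroup F" using x gen_subgroup_insert[of z F] by blast
      obtain c where c: "u - lat n' y' c \<in> B" using IH(5)[OF ku(2)] by blast
      have "lat n' (y'(n' := z)) (c(n' := k)) = lat n' y' c" by (rule lat_cong) auto
      then have "x - lat (Suc n') (y'(n' := z)) (c(n' := k)) = u - lat n' y' c"
        by (simp add: lat_Suc ku(1))
      then show ?thesis using c by metis
    qed
    moreover have "n \<le> Suc n'" "\<forall>i<n. (y'(n' := z)) i = y i" using IH by auto
    ultimately show ?thesis using True IH(4) by blast
  next
    case False
    obtain B2 where B2: "rel_compact B2" "\<And>k. \<exists>c. zmul k z - lat n' y' c \<in> B2"
      using proper_lat_extend_or_bounded[OF IH(3) False] by blast
    have "\<exists>c. x - lat n' y' c \<in> B + B2" if x: "x \<in> gen_subgroup (insert z F)" for x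
    proof -
      obtain k u where ku: "x = zmul k z + u" "u \<in> gen_subgroup F" using x gen_subgroup_insert[of z F] by blast
      obtain c where c: "u - lat n' y' c \<in> B" using IH(5)[OF ku(2)] by blast
      obtain d where d: "zmul k z - lat n' y' d \<in> B2" using B2 by blast
      show ?thesis
        by (intro exI[of _ "\<lambda>i. c i + d i"] mem_plus[OF c d]) (simp add: ku lat_add)
    qed
    then show ?thesis using IH rel_compact_plus[OF IH(4) B2(1)] by blast
  qed
qed

text \<open>If \<open>C\<close> is symmetric, contains \<open>U\<close>, and finitely many
  translates of \<open>U\<close> by \<open>F\<close> cover \<open>C + C\<close>, then the points
  within \<open>C\<close> of the group generated by \<open>F\<close> form a subgroup: the sum of two
  errors is an error plus an element of \<open>F\<close>.\<close>

lemma gen_subgroup_rel_compact: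
  fixes B :: "'a set"
  assumes "rel_compact B"
  obtains F C where "finite F" "rel_compact C" "\<And>x. x \<in> gen_subgroup B \<Longrightarrow> \<exists>u\<in>gen_subgroup F. x - u \<in> C"
proof -
  obtain U V :: "'a set" where UV: "open U" "0 \<in> U" "rel_compact V"
    "\<And>a b c d. a \<in> U \<Longrightarrow> b \<in> U \<Longrightarrow> c \<in> U \<Longrightarrow> d \<in> U \<Longrightarrow> (a - b) - (c - d) \<in> V"
    using small_neighbourhood by blast
  have UV': "a \<in> V" if "a \<in> U" for a using UV(4)[OF that UV(2) UV(2) UV(2)] by simp
  define C0 C where "C0 = B \<union> V" and "C = C0 \<union> uminus ` C0"
  have C: "rel_compact C" unfolding C_def C0_def by (intro rel_compact_Un rel_compact_uminus assms UV)
  have Cneg: "- a \<in> C" if "a \<in> C" for a using that by (auto simp: C_def)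
  have "0 \<in> C" using UV' UV(2) by (auto simp: C_def C0_def)
  obtain F where F: "finite F" "\<And>b. b \<in> C + C \<Longrightarrow> \<exists>f\<in>F. b - f \<in> U"
    using rel_compact_cover[OF rel_compact_plus[OF C C] UV(1,2)] by blast
  note G = is_subgroupD[OF is_subgroup_gen[of F]]
  have "gen_subgroup B \<subseteq> {x. \<exists>u\<in>gen_subgroup F. x - u \<in> C}"
  proof (rule gen_subgroup_least)
    show "B \<subseteq> {x. \<exists>u\<in>gen_subgroup F. x - u \<in> C}"
      using G(1) by (auto simp: C_def C0_def intro!: bexI[of _ 0])
    show "is_subgroup {x. \<exists>u\<in>gen_subgroup F. x - u \<in> C}"
      unfolding is_subgroup_def
    proof (intro conjI ballI)
      show "0 \<in> {x. \<exists>u\<in>gen_subgroup F. x - u \<in> C}" using G(1) \<open>0 \<in> C\<close> by (auto intro!: bexI[of _ 0])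
    next
      fix x y assume "x \<in> {x. \<exists>u\<in>gen_subgroup F. x - u \<in> C}" "y \<in> {x. \<exists>u\<in>gen_subgroup F. x - u \<in> C}"
      then obtain u v where uv: "u \<in> gen_subgroup F" "v \<in> gen_subgroup F" "x - u \<in> C" "y - v \<in> C" by blast
      then have "(x - u) + (y - v) \<in> C + C" by blast
      then obtain f where f: "f \<in> F" "(x - u) + (y - v) - f \<in> U" using F(2) by blast
      then have "(x - u) + (y - v) - f \<in> C" using UV' by (auto simp: C_def C0_def)
      then have "(x + y) - (u + v + f) \<in> C" by (simp add: algebra_simps)
      then show "x + y \<in> {x. \<exists>u\<in>gen_subgroup F. x - u \<in> C}"
        using uv f G(2) gen_subgroup_superset[of F] by blast
    next
      fix x assume "x \<in> {x. \<exists>u\<in>gen_subgroup F. x - u \<in> C}"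
      then obtain u where u: "u \<in> gen_subgroup F" "x - u \<in> C" by blast
      then have "- x - (- u) \<in> C" using Cneg[OF u(2)] by simp
      then show "- x \<in> {x. \<exists>u\<in>gen_subgroup F. x - u \<in> C}" using G(3)[OF u(1)] by blast
    qed
  qed
  then show thesis using that[OF F(1) C] by blast
qed

lemma gen_subgroup_cocompact_lat:
  fixes y :: "nat \<Rightarrow> 'a"
  assumes "rel_compact B" "proper_lat n y"
  obtains n' y' C where "n \<le> n'" "\<And>i. i < n \<Longrightarrow> y' i = y i" "proper_lat n' y'" "rel_compact C"
    "\<And>x. x \<in> gen_subgroup B \<Longrightarrow> \<exists>c. x - lat n' y' c \<in> C"
proof -
  obtain F C where F: "finite F" "rel_compact C" "\<And>x. x \<in> gen_subgroup B \<Longrightarrow> \<exists>u\<in>gen_subgroup F. x - u \<in> C"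
    using gen_subgroup_rel_compact[OF assms(1)] by blast
  obtain n' y' D where D: "n \<le> n'" "\<forall>i<n. y' i = y i" "proper_lat n' y'" "rel_compact D"
    "\<And>x. x \<in> gen_subgroup F \<Longrightarrow> \<exists>c. x - lat n' y' c \<in> D"
    using gen_subgroup_finite_rank[OF F(1) assms(2)] by blast
  have "\<exists>c. x - lat n' y' c \<in> C + D" if x: "x \<in> gen_subgroup B" for x
  proof -
    obtain u where u: "u \<in> gen_subgroup F" "x - u \<in> C" using F(3)[OF x] by blast
    obtain c where c: "u - lat n' y' c \<in> D" using D(5)[OF u(1)] by blast
    show ?thesis by (intro exI[of _ c] mem_plus[OF u(2) c]) simp
  qed
  then show thesis using that[of n' y' "C + D"] D rel_compact_plus[OF F(2) D(4)] by blast
qed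

end

section \<open>Asymptotic dimension and small sets\<close>

lemma asdim_le_mono: "asdim_le A E m \<Longrightarrow> m \<le> n \<Longrightarrow> asdim_le A E n"
  unfolding asdim_le_def by (meson Suc_le_mono order_trans)

lemma neg_one_ereal: "(- 1 :: ereal) = ereal (- 1)"
  by (simp add: one_ereal_def)

text \<open>The empty set has dimension -1 and thus stays below \<open>n = 0\<close>; the condition
  \<open>0 < n\<close> guards the truncated subtraction.\<close>

lemma asdim_less_iff:
  "asdim A E < ereal (real n) \<longleftrightarrow> A = {} \<or> (0 < n \<and> asdim_le A E (n - 1))"
proof (cases "A = {} \<or> (\<nexists>m. asdim_le A E m)")
  case True
  then show ?thesis by (auto simp: asdim_def neg_one_ereal)
next
  case False
  define m where "m = (LEAST m. asdim_le A E m)"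
  have m: "asdim_le A E m" unfolding m_def using False by (auto intro: LeastI_ex)
  have "asdim A E < ereal (real n) \<longleftrightarrow> m < n" using False by (simp add: asdim_def m_def)
  also have "\<dots> \<longleftrightarrow> 0 < n \<and> asdim_le A E (n - 1)"
  proof
    assume "m < n"
    then show "0 < n \<and> asdim_le A E (n - 1)" using asdim_le_mono[OF m, of "n - 1"] by auto
  next
    assume n: "0 < n \<and> asdim_le A E (n - 1)"
    then have "m \<le> n - 1" unfolding m_def by (auto intro: Least_le)
    then show "m < n" using n by auto
  qed
  finally show ?thesis using False by blast
qed

lemma asdim_le_imp: "asdim_le A E n \<Longrightarrow> asdim A E \<le> ereal (real n)"
  by (auto simp: asdim_def neg_one_ereal intro: Least_le)

lemma asdim_eqI:
  assumes "A \<noteq> {}" "asdim_le A E n" "0 < n \<Longrightarrow> \<not> asdim_le A E (n - 1)"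
  shows "asdim A E = ereal (real n)"
  using asdim_le_imp[OF assms(2)] asdim_less_iff[of A E n] assms by (auto simp: not_less intro: antisym)

lemma colourable_subset: "colourable n S m \<Longrightarrow> S' \<subseteq> S \<Longrightarrow> colourable n S' m"
  unfolding colourable_def
proof
  fix r assume *: "\<forall>r. \<exists>(k :: (nat \<Rightarrow> int) \<Rightarrow> nat) (l :: (nat \<Rightarrow> int) \<Rightarrow> nat \<Rightarrow> int) D. (\<forall>x\<in>S. k x \<le> m) \<and>
     (\<forall>x\<in>S. \<forall>y\<in>S. k x = k y \<longrightarrow> (\<forall>i<n. \<bar>x i - y i\<bar> \<le> r) \<longrightarrow> l x = l y) \<and>
     (\<forall>x\<in>S. \<forall>y\<in>S. l x = l y \<longrightarrow> (\<forall>i<n. \<bar>x i - y i\<bar> \<le> D))" and sub: "S' \<subseteq> S"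
  show "\<exists>(k :: (nat \<Rightarrow> int) \<Rightarrow> nat) (l :: (nat \<Rightarrow> int) \<Rightarrow> nat \<Rightarrow> int) D. (\<forall>x\<in>S'. k x \<le> m) \<and>
     (\<forall>x\<in>S'. \<forall>y\<in>S'. k x = k y \<longrightarrow> (\<forall>i<n. \<bar>x i - y i\<bar> \<le> r) \<longrightarrow> l x = l y) \<and>
     (\<forall>x\<in>S'. \<forall>y\<in>S'. l x = l y \<longrightarrow> (\<forall>i<n. \<bar>x i - y i\<bar> \<le> D))"
  proof -
    obtain k l D where "\<forall>x\<in>S. k x \<le> m"
      "\<forall>x\<in>S. \<forall>y\<in>S. k x = k y \<longrightarrow> (\<forall>i<n. \<bar>x i - y i\<bar> \<le> r) \<longrightarrow> l x = (l y :: nat \<Rightarrow> int)"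
      "\<forall>x\<in>S. \<forall>y\<in>S. l x = l y \<longrightarrow> (\<forall>i<n. \<bar>x i - y i\<bar> \<le> D)"
      using spec[OF *, of r] by (elim exE conjE)
    then show ?thesis using sub by (intro exI[of _ k] exI[of _ l] exI[of _ D] conjI) blast+
  qed
qed

lemma sub_coarse_UNIV: "sub_coarse UNIV E = E"
  by (auto simp: sub_coarse_def)

context lca_group
begin

section \<open>Entourages and covers in terms of relatively compact sets\<close>

text \<open>Symmetry and the diagonal are built in, since members of \<open>group_coarse\<close>
  must have both while \<open>B\<close> is arbitrary.\<close>

definition ent :: "'a set \<Rightarrow> ('a \<times> 'a) set" where
  "ent B = {(x, y). x - y \<in> B \<or> y - x \<in> B \<or> x = y}"

lemma ent_in_group_coarse:
  assumes "rel_compact B"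
  shows "ent B \<in> group_coarse"
proof -
  obtain K where K: "compact K" "B \<subseteq> K" using assms by (auto simp: rel_compact_def)
  define K' where "K' = insert 0 (K \<union> uminus ` K)"
  have "compact K'"
    unfolding K'_def by (intro compact_insert compact_Un K compact_continuous_image continuous_on_subset[OF neg_cont]) auto
  moreover have "uminus ` K' = K'" by (auto simp: K'_def image_Un image_image)
  moreover have "0 \<in> K'" by (simp add: K'_def)
  moreover have "ent B \<subseteq> {(x, y). x \<in> (\<lambda>k. y + k) ` K'}"
  proof clarify
    fix x y assume "(x, y) \<in> ent B"
    then have "x - y \<in> K \<or> - (x - y) \<in> K \<or> x - y = 0" using K(2) by (auto simp: ent_def)
    moreover have "x - y \<in> uminus ` K" if "- (x - y) \<in> K"
      using that by (metis imageI minus_minus)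
    ultimately have "x - y \<in> K'" by (auto simp: K'_def)
    then show "x \<in> (\<lambda>k. y + k) ` K'" by (intro image_eqI[of _ _ "x - y"]) auto
  qed
  ultimately show ?thesis
    unfolding group_coarse_def by (auto simp: ent_def sym_def)
qed

lemma group_coarseD:
  assumes "\<epsilon> \<in> (group_coarse :: ('a \<times> 'a) set set)"
  obtains B where "rel_compact B" "\<And>x y. (x, y) \<in> \<epsilon> \<Longrightarrow> x - y \<in> B" "\<And>x y. (x, y) \<in> \<epsilon> \<Longrightarrow> (y, x) \<in> \<epsilon>"
proof -
  obtain K where K: "compact K" "\<epsilon> \<subseteq> {(x, y). x \<in> (\<lambda>k. y + k) ` K}" "sym \<epsilon>"
    using assms by (auto simp: group_coarse_def)
  have "x - y \<in> K" if "(x, y) \<in> \<epsilon>" for x y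
  proof -
    have "x \<in> (\<lambda>k. y + k) ` K" using K(2) that by blast
    then show ?thesis by auto
  qed
  then show thesis using that[of K] K by (auto simp: rel_compact_def sym_def)
qed

lemma large_iff:
  "large_set UNIV group_coarse A \<longleftrightarrow> (\<exists>B. rel_compact B \<and> (\<forall>x. \<exists>a\<in>A. x - a \<in> B))" for A :: "'a set"
proof
  assume "large_set UNIV group_coarse A"
  then obtain \<epsilon> where e: "\<epsilon> \<in> group_coarse" "cballset_e \<epsilon> A = UNIV" by (auto simp: large_set_def)
  obtain B where B: "rel_compact B" "\<And>x y. (x, y) \<in> \<epsilon> \<Longrightarrow> x - y \<in> B" "\<And>x y. (x, y) \<in> \<epsilon> \<Longrightarrow> (y, x) \<in> \<epsilon>"
    using group_coarseD[OF e(1)] by blast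
  have "\<exists>a\<in>A. x - a \<in> B" for x
  proof -
    have "x \<in> cballset_e \<epsilon> A" using e(2) by simp
    then obtain a where "a \<in> A" "(a, x) \<in> \<epsilon>" by (auto simp: cballset_e_def cball_e_def)
    then show ?thesis using B(2,3) by blast
  qed
  then show "\<exists>B. rel_compact B \<and> (\<forall>x. \<exists>a\<in>A. x - a \<in> B)" using B(1) by blast
next
  assume "\<exists>B. rel_compact B \<and> (\<forall>x. \<exists>a\<in>A. x - a \<in> B)"
  then obtain B where B: "rel_compact B" "\<forall>x. \<exists>a\<in>A. x - a \<in> B" by blast
  have "cballset_e (ent B) A = UNIV"
    using B(2) by (auto simp: cballset_e_def cball_e_def ent_def)
  then show "large_set UNIV group_coarse A"
    using ent_in_group_coarse[OF B(1)] by (auto simp: large_set_def)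
qed

text \<open>The cover consists of the joint classes of colour and label; a ball meets at most one
  class of each colour. The type of labels is left free because coset representatives are added to
  them later.\<close>

lemma asdim_leI:
  fixes A :: "'a set"
  assumes col: "\<And>B. rel_compact B \<Longrightarrow> \<exists>(k :: 'a \<Rightarrow> nat) (l :: 'a \<Rightarrow> 'l) D. rel_compact D \<and> (\<forall>x\<in>A. k x \<le> m)
    \<and> (\<forall>x\<in>A. \<forall>y\<in>A. k x = k y \<longrightarrow> x - y \<in> B \<longrightarrow> l x = l y) \<and> (\<forall>x\<in>A. \<forall>y\<in>A. l x = l y \<longrightarrow> x - y \<in> D)"
  shows "asdim_le A (sub_coarse A group_coarse) m"
  unfolding asdim_le_def
proof
  fix \<epsilon>' assume "\<epsilon>' \<in> sub_coarse A group_coarse"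
  then obtain \<epsilon> where e: "\<epsilon> \<in> group_coarse" "\<epsilon>' = \<epsilon> \<inter> (A \<times> A)" by (auto simp: sub_coarse_def)
  obtain B where B: "rel_compact B" "\<And>x y. (x, y) \<in> \<epsilon> \<Longrightarrow> x - y \<in> B" "\<And>x y. (x, y) \<in> \<epsilon> \<Longrightarrow> (y, x) \<in> \<epsilon>"
    using group_coarseD[OF e(1)] by blast
  \<comment> \<open>Two points of one ball differ by an element of \<open>B + B\<close>, so the
    colouring is taken at this scale.\<close>
  obtain k :: "'a \<Rightarrow> nat" and l :: "'a \<Rightarrow> 'l" and D where D: "rel_compact D" "\<And>x. x \<in> A \<Longrightarrow> k x \<le> m"
    "\<And>x y. x \<in> A \<Longrightarrow> y \<in> A \<Longrightarrow> k x = k y \<Longrightarrow> x - y \<in> B + B \<Longrightarrow> l x = l y"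
    "\<And>x y. x \<in> A \<Longrightarrow> y \<in> A \<Longrightarrow> l x = l y \<Longrightarrow> x - y \<in> D"
    using col[OF rel_compact_plus[OF B(1) B(1)]] by blast
  define piece where "piece j b = {y \<in> A. k y = j \<and> l y = b}" for j b
  define \<U> where "\<U> = (\<lambda>x. piece (k x) (l x)) ` A"
  show "\<exists>\<U>. \<Union>\<U> = A \<and> (\<exists>\<delta>\<in>sub_coarse A group_coarse. mesh \<U> \<subseteq> \<delta>) \<and>
    (\<forall>x\<in>A. finite {U \<in> \<U>. U \<inter> cball_e \<epsilon>' x \<noteq> {}} \<and> card {U \<in> \<U>. U \<inter> cball_e \<epsilon>' x \<noteq> {}} \<le> Suc m)"
  proof (intro exI[of _ \<U>] conjI ballI)
    show "\<Union>\<U> = A" by (auto simp: \<U>_def piece_def)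
    have "mesh \<U> \<subseteq> ent D \<inter> (A \<times> A)" using D(4) by (auto simp: mesh_def \<U>_def piece_def ent_def)
    then show "\<exists>\<delta>\<in>sub_coarse A group_coarse. mesh \<U> \<subseteq> \<delta>"
      using ent_in_group_coarse[OF D(1)] by (auto simp: sub_coarse_def)
    fix x assume x: "x \<in> A"
    define b where "b j = l (SOME y. (x, y) \<in> \<epsilon>' \<and> k y = j)" for j
    have sub: "{U \<in> \<U>. U \<inter> cball_e \<epsilon>' x \<noteq> {}} \<subseteq> (\<lambda>j. piece j (b j)) ` {..m}"
    proof clarify
      fix U y assume U: "U \<in> \<U>" "U \<inter> cball_e \<epsilon>' x \<noteq> {}"
      then obtain y where y: "y \<in> U" "(x, y) \<in> \<epsilon>'" by (auto simp: cball_e_def)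
      have Uy: "U = piece (k y) (l y)" and yA: "y \<in> A" using U(1) y(1) by (auto simp: \<U>_def piece_def)
      define y' where "y' = (SOME y'. (x, y') \<in> \<epsilon>' \<and> k y' = k y)"
      have y': "(x, y') \<in> \<epsilon>' \<and> k y' = k y" unfolding y'_def by (rule someI[of _ y]) (use y in auto)
      have "y' - x \<in> B" "x - y \<in> B" using B y(2) y' e(2) by auto
      then have "y' - y \<in> B + B" by (rule mem_plus) simp
      then have "l y' = l y" using y' e(2) yA by (intro D(3)) auto
      then have "U = piece (k y) (b (k y))" using Uy by (simp add: b_def y'_def)
      then show "U \<in> (\<lambda>j. piece j (b j)) ` {..m}" using D(2)[OF yA] by auto
    qed
    show "finite {U \<in> \<U>. U \<inter> cball_e \<epsilon>' x \<noteq> {}}" by (rule finite_subset[OF sub]) simp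
    have "card {U \<in> \<U>. U \<inter> cball_e \<epsilon>' x \<noteq> {}} \<le> card ((\<lambda>j. piece j (b j)) ` {..m})"
      by (rule card_mono[OF _ sub]) simp
    also have "\<dots> \<le> Suc m" using card_image_le[of "{..m}" "\<lambda>j. piece j (b j)"] by simp
    finally show "card {U \<in> \<U>. U \<inter> cball_e \<epsilon>' x \<noteq> {}} \<le> Suc m" .
  qed
qed

lemma asdim_leD:
  fixes A B :: "'a set"
  assumes "asdim_le A (sub_coarse A group_coarse) m" "rel_compact B"
  obtains \<U> D where "\<Union>\<U> = A" "rel_compact D" "\<And>U x y. U \<in> \<U> \<Longrightarrow> x \<in> U \<Longrightarrow> y \<in> U \<Longrightarrow> x - y \<in> D"
    "\<And>x. x \<in> A \<Longrightarrow> finite {U \<in> \<U>. \<exists>y\<in>U. x - y \<in> B}" "\<And>x. x \<in> A \<Longrightarrow> card {U \<in> \<U>. \<exists>y\<in>U. x - y \<in> B} \<le> Suc m"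
proof -
  have "ent B \<inter> (A \<times> A) \<in> sub_coarse A group_coarse"
    unfolding sub_coarse_def using ent_in_group_coarse[OF assms(2)] by blast
  from bspec[OF assms(1)[unfolded asdim_le_def] this]
  obtain \<U> \<delta> where U: "\<Union>\<U> = A" "\<delta> \<in> sub_coarse A group_coarse" "mesh \<U> \<subseteq> \<delta>"
    "\<forall>x\<in>A. finite {U \<in> \<U>. U \<inter> cball_e (ent B \<inter> (A \<times> A)) x \<noteq> {}}
       \<and> card {U \<in> \<U>. U \<inter> cball_e (ent B \<inter> (A \<times> A)) x \<noteq> {}} \<le> Suc m"
    by (elim exE conjE bexE)
  obtain \<delta>' where d: "\<delta>' \<in> group_coarse" "\<delta> = \<delta>' \<inter> (A \<times> A)" using U(2) by (auto simp: sub_coarse_def)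
  obtain D where D: "rel_compact D" "\<And>x y. (x, y) \<in> \<delta>' \<Longrightarrow> x - y \<in> D"
    using group_coarseD[OF d(1)] by metis
  have sub: "{U \<in> \<U>. \<exists>y\<in>U. x - y \<in> B} \<subseteq> {U \<in> \<U>. U \<inter> cball_e (ent B \<inter> (A \<times> A)) x \<noteq> {}}"
    if "x \<in> A" for x
  proof
    fix U assume "U \<in> {U \<in> \<U>. \<exists>y\<in>U. x - y \<in> B}"
    then obtain y where U': "U \<in> \<U>" "y \<in> U" "x - y \<in> B" by blast
    then have "y \<in> A" using U(1) by blast
    then have "y \<in> U \<inter> cball_e (ent B \<inter> (A \<times> A)) x" using U' that by (simp add: cball_e_def ent_def)
    then show "U \<in> {U \<in> \<U>. U \<inter> cball_e (ent B \<inter> (A \<times> A)) x \<noteq> {}}" using U'(1) by blast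
  qed
  show thesis
  proof (rule that[of \<U> D])
    show "x - y \<in> D" if "U \<in> \<U>" "x \<in> U" "y \<in> U" for U x y
    proof -
      have "(x, y) \<in> mesh \<U>" using that by (auto simp: mesh_def)
      then show ?thesis using U(3) d(2) D(2) by auto
    qed
    show "finite {U \<in> \<U>. \<exists>y\<in>U. x - y \<in> B}" if "x \<in> A" for x
      using bspec[OF U(4) that] finite_subset[OF sub[OF that]] by blast
    show "card {U \<in> \<U>. \<exists>y\<in>U. x - y \<in> B} \<le> Suc m" if "x \<in> A" for x
      using bspec[OF U(4) that] card_mono[OF _ sub[OF that]] by linarith
  qed (use U D in auto)
qed

text \<open>Lebesgue's covering theorem for large lattice cubes, from Kuhn's version of Sperner's lemma: a lattice
  point is labelled by the faces \<open>x\<^sub>j = p\<close> that are met by the chosen member of the cover containing it.\<close>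

lemma not_asdim_le_if_cubes:
  fixes A K :: "'a set"
  assumes proper: "proper_lat n y" and n: "0 < n" and K: "rel_compact K"
    and cubes: "\<And>p::nat. \<exists>t. \<forall>c. (\<forall>i<n. 0 \<le> c i \<and> c i \<le> int p) \<longrightarrow> (\<exists>b\<in>A. t + lat n y c - b \<in> K)"
  shows "\<not> asdim_le A (sub_coarse A group_coarse) (n - 1)"
proof
  assume asd: "asdim_le A (sub_coarse A group_coarse) (n - 1)"
  define B where "B = {lat n y c |c. \<forall>i<n. \<bar>c i\<bar> \<le> 1} + (K + uminus ` K)"
  have "rel_compact B" unfolding B_def by (intro rel_compact_plus rel_compact_box rel_compact_minus K)
  then obtain \<U> D where U: "\<Union>\<U> = A" "rel_compact D"
    "\<And>U x y. U \<in> \<U> \<Longrightarrow> x \<in> U \<Longrightarrow> y \<in> U \<Longrightarrow> x - y \<in> D"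
    "\<And>x. x \<in> A \<Longrightarrow> finite {U \<in> \<U>. \<exists>y\<in>U. x - y \<in> B}"
    "\<And>x. x \<in> A \<Longrightarrow> card {U \<in> \<U>. \<exists>y\<in>U. x - y \<in> B} \<le> Suc (n - 1)"
    using asdim_leD[OF asd] by blast
  have "rel_compact (D + (K + uminus ` K))" by (intro rel_compact_plus rel_compact_minus K U)
  then obtain M where M: "\<And>c i. lat n y c \<in> D + (K + uminus ` K) \<Longrightarrow> i < n \<Longrightarrow> \<bar>c i\<bar> \<le> M"
    using proper_latD[OF proper] by blast
  \<comment> \<open>The side exceeds the bound \<open>M\<close> on the lattice width of a member of
    the cover, so no chosen member serves two opposite faces of the cube.\<close>
  define p where "p = nat M + 1"
  have p: "0 < p" "M < int p" by (auto simp: p_def)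
  obtain t where t: "\<And>c. (\<forall>i<n. 0 \<le> c i \<and> c i \<le> int p) \<Longrightarrow> (\<exists>b\<in>A. t + lat n y c - b \<in> K)"
    using cubes[of p] by blast
  define V where "V = {x :: nat \<Rightarrow> nat. \<forall>i<n. x i \<le> p}"
  define \<phi> where "\<phi> x = lat n y (\<lambda>i. int (x i))" for x :: "nat \<Rightarrow> nat"
  have "\<forall>x\<in>V. \<exists>b. b \<in> A \<and> t + \<phi> x - b \<in> K"
  proof
    fix x assume "x \<in> V"
    then have "\<exists>b\<in>A. t + lat n y (\<lambda>i. int (x i)) - b \<in> K" by (intro t) (auto simp: V_def)
    then show "\<exists>b. b \<in> A \<and> t + \<phi> x - b \<in> K" by (auto simp: \<phi>_def)
  qed
  from bchoice[OF this] obtain b where b: "\<And>x. x \<in> V \<Longrightarrow> b x \<in> A" "\<And>x. x \<in> V \<Longrightarrow> t + \<phi> x - b x \<in> K" by blast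
  have "\<forall>x\<in>V. \<exists>U. U \<in> \<U> \<and> b x \<in> U" using b(1) U(1) by blast
  from bchoice[OF this] obtain u where u: "\<And>x. x \<in> V \<Longrightarrow> u x \<in> \<U>" "\<And>x. x \<in> V \<Longrightarrow> b x \<in> u x" by blast
  \<comment> \<open>The label is a function of the member of the cover alone, so distinct reduced
    labels force distinct members.\<close>
  define lab' where "lab' W j = (if \<exists>c\<in>V. c j = p \<and> u c = W then 1 else 0 :: nat)" for W j
  define lab where "lab x = lab' (u x)" for x
  have "odd (card {s. ksimplex p n s \<and> (reduced n \<circ> lab) ` s = {..n}})"
  proof (rule kuhn_combinatorial[OF p(1)]; intro allI impI; elim conjE)
    fix x :: "nat \<Rightarrow> nat" and j assume x: "\<forall>j. x j \<le> p" "j < n" "x j = 0"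
    have xV: "x \<in> V" using x by (auto simp: V_def)
    have "\<not> (\<exists>c\<in>V. c j = p \<and> u c = u x)"
    proof
      assume "\<exists>c\<in>V. c j = p \<and> u c = u x"
      then obtain c where c: "c \<in> V" "c j = p" "u c = u x" by blast
      have D: "b c - b x \<in> D" using U(3)[OF u(1)[OF xV]] u(2)[OF xV] u(2)[OF c(1)] c(3) by auto
      have KK: "(t + \<phi> c - b c) - (t + \<phi> x - b x) \<in> K + uminus ` K"
        by (rule mem_minus[OF b(2)[OF c(1)] b(2)[OF xV]]) simp
      have "lat n y (\<lambda>i. int (c i) - int (x i)) \<in> D + (K + uminus ` K)"
        by (rule mem_plus[OF D KK]) (simp add: lat_diff \<phi>_def)
      then have "\<bar>int (c j) - int (x j)\<bar> \<le> M" by (rule M) (rule x(2))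
      then show False using c(2) x(3) p(2) by simp
    qed
    then show "lab x j = 0" by (simp add: lab_def lab'_def)
  next
    fix x :: "nat \<Rightarrow> nat" and j assume x: "\<forall>j. x j \<le> p" "j < n" "x j = p"
    then have "x \<in> V" by (auto simp: V_def)
    then show "lab x j = 1" using x by (auto simp: lab_def lab'_def)
  qed
  then obtain s where s: "ksimplex p n s" "(reduced n \<circ> lab) ` s = {..n}"
    by (metis (mono_tags, lifting) odd_card_imp_not_empty empty_Collect_eq)
  obtain b0 u0 where "kuhn_simplex p n b0 u0 s" using s(1) by (auto elim: ksimplex.cases)
  then interpret S: kuhn_simplex p n b0 u0 s .
  have sV: "x \<in> V" if "x \<in> s" for x using S.s_space that by (fastforce simp: V_def)
  have "s \<noteq> {}" using s(2) by auto
  then obtain x0 where x0: "x0 \<in> s" by blast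
  have sub: "u ` s \<subseteq> {U \<in> \<U>. \<exists>y\<in>U. b x0 - y \<in> B}"
  proof clarify
    fix x assume x: "x \<in> s"
    have KK: "(t + \<phi> x - b x) - (t + \<phi> x0 - b x0) \<in> K + uminus ` K"
      by (rule mem_minus[OF b(2)[OF sV[OF x]] b(2)[OF sV[OF x0]]]) simp
    have "\<bar>int (x0 i) - int (x i)\<bar> \<le> 1" for i
      using S.base_le[OF x, of i] S.base_le[OF x0, of i] S.le_Suc_base[OF x, of i] S.le_Suc_base[OF x0, of i]
      by linarith
    then have "lat n y (\<lambda>i. int (x0 i) - int (x i)) \<in> {lat n y c |c. \<forall>i<n. \<bar>c i\<bar> \<le> 1}" by auto
    then have "b x0 - b x \<in> B"
      unfolding B_def by (rule mem_plus[OF _ KK]) (simp add: lat_diff \<phi>_def)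
    then show "u x \<in> \<U> \<and> (\<exists>y\<in>u x. b x0 - y \<in> B)" using u sV[OF x] by blast
  qed
  have fin: "finite {U \<in> \<U>. \<exists>y\<in>U. b x0 - y \<in> B}" using U(4) b(1) sV[OF x0] by blast
  \<comment> \<open>All \<open>n + 1\<close> reduced labels occur on one simplex, whose vertices
    differ by at most 1 in each coordinate. Hence \<open>n + 1\<close> members meet one ball,
    against the bound \<open>n\<close>.\<close>
  have "{..n} = (\<lambda>W. reduced n (lab' W)) ` (u ` s)" using s(2) by (auto simp: lab_def image_image)
  then have "card {..n} \<le> card (u ` s)"
    using card_image_le[of "u ` s" "\<lambda>W. reduced n (lab' W)"] finite_subset[OF sub fin] by simp
  also have "\<dots> \<le> card {U \<in> \<U>. \<exists>y\<in>U. b x0 - y \<in> B}" by (rule card_mono[OF fin sub])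
  also have "\<dots> \<le> n" using U(5)[OF b(1)[OF sV[OF x0]]] n by simp
  finally show False by simp
qed

section \<open>Small sets, small subgroups and transfer of colourings\<close>

text \<open>Points outside the set \<open>R\<close> of \<open>K\<close>-distant points are within
  \<open>K\<close> of \<open>A\<close>, so the union of \<open>R\<close> and \<open>A\<close> is
  large. Removing the small set \<open>A\<close> leaves a large part of \<open>R\<close>.\<close>

lemma small_imp_complement_large:
  fixes A K :: "'a set"
  assumes "small_set UNIV group_coarse A" "rel_compact K" "0 \<in> K"
  obtains B where "rel_compact B" "\<And>x. \<exists>t. x - t \<in> B \<and> (\<forall>a\<in>A. t - a \<notin> K)"
proof -
  define R where "R = {t. \<forall>a\<in>A. t - a \<notin> K}"
  have "\<exists>a\<in>R \<union> A. x - a \<in> K" for x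
  proof (cases "x \<in> R")
    case True
    then show ?thesis using assms(3) by (intro bexI[of _ x]) auto
  qed (auto simp: R_def)
  then have "large_set UNIV group_coarse (R \<union> A)" using assms(2) by (auto simp: large_iff)
  then have "large_set UNIV group_coarse ((R \<union> A) - A)" using assms(1) by (auto simp: small_set_def)
  then obtain B where "rel_compact B" "\<forall>x. \<exists>a\<in>(R \<union> A) - A. x - a \<in> B" by (auto simp: large_iff)
  then show thesis using that[of B] by (auto simp: R_def)
qed

text \<open>Let \<open>t\<close> be far from \<open>H\<close>. If the point of \<open>L\<close> near
  \<open>x\<close> is in \<open>H\<close>, the one near \<open>x + t\<close> cannot be, since the
  difference of the two would be an element of \<open>H\<close> close to \<open>t\<close>. It still
  approximates \<open>x\<close>, with an error shifted by \<open>t\<close>.\<close>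

lemma small_subgroup:
  fixes H :: "'a set"
  assumes H: "is_subgroup H" and not_large: "\<And>K. rel_compact K \<Longrightarrow> \<exists>x. \<forall>h\<in>H. x - h \<notin> K"
  shows "small_set UNIV group_coarse H"
  unfolding small_set_def
proof (intro conjI allI impI)
  fix L :: "'a set" assume "large_set UNIV group_coarse L"
  then obtain B where B: "rel_compact B" "\<And>x. \<exists>l\<in>L. x - l \<in> B" by (auto simp: large_iff)
  obtain t where t: "\<And>h. h \<in> H \<Longrightarrow> t - h \<notin> B + uminus ` B"
    using not_large[OF rel_compact_minus[OF B(1) B(1)]] by blast
  have "\<exists>l\<in>L - H. x - l \<in> B \<union> (B + uminus ` {t})" for x
  proof -
    obtain l where l: "l \<in> L" "x - l \<in> B" using B(2) by blast
    show ?thesis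
    proof (cases "l \<in> H")
      case True
      obtain l' where l': "l' \<in> L" "x + t - l' \<in> B" using B(2) by blast
      have "l' \<notin> H"
      proof
        assume "l' \<in> H"
        then have "l' - l \<in> H" using True H by (auto intro: is_subgroupD)
        moreover have "t - (l' - l) \<in> B + uminus ` B"
          by (rule mem_minus[OF l'(2) l(2)]) (simp add: algebra_simps)
        ultimately show False using t by blast
      qed
      moreover have "x - l' \<in> B + uminus ` {t}" by (rule mem_minus[OF l'(2)]) auto
      ultimately show ?thesis using l'(1) by blast
    qed (use l in blast)
  qed
  then show "large_set UNIV group_coarse (L - H)"
    unfolding large_iff
    using rel_compact_Un[OF B(1) rel_compact_minus[OF B(1) rel_compact_finite[of "{t}"]]] by blast
qed simp

text \<open>Rounding to lattice coefficients changes differences only by \<open>C - C\<close>.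
  Properness turns closeness in the group into a bound on coefficients; boxes turn bounded
  coefficients back into relatively compact sets.\<close>

lemma colouring_pullback:
  fixes A B C :: "'a set"
  assumes proper: "proper_lat n y" and C: "rel_compact C" and g: "\<forall>x\<in>A. x - lat n y (g x) \<in> C"
    and col: "colourable n (g ` A) m" and B: "rel_compact B"
  shows "\<exists>(k :: 'a \<Rightarrow> nat) (l :: 'a \<Rightarrow> nat \<Rightarrow> int) D. rel_compact D \<and> (\<forall>x\<in>A. k x \<le> m)
    \<and> (\<forall>x\<in>A. \<forall>y\<in>A. k x = k y \<longrightarrow> x - y \<in> B \<longrightarrow> l x = l y) \<and> (\<forall>x\<in>A. \<forall>y\<in>A. l x = l y \<longrightarrow> x - y \<in> D)"
proof -
  have "rel_compact (B + uminus ` (C + uminus ` C))" by (intro rel_compact_minus B C)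
  then obtain r where r: "\<And>c i. lat n y c \<in> B + uminus ` (C + uminus ` C) \<Longrightarrow> i < n \<Longrightarrow> \<bar>c i\<bar> \<le> r"
    using proper_latD[OF proper] by blast
  obtain k :: "(nat \<Rightarrow> int) \<Rightarrow> nat" and l :: "(nat \<Rightarrow> int) \<Rightarrow> nat \<Rightarrow> int" and M
    where k: "\<forall>x\<in>g ` A. k x \<le> m"
      "\<forall>x\<in>g ` A. \<forall>y\<in>g ` A. k x = k y \<longrightarrow> (\<forall>i<n. \<bar>x i - y i\<bar> \<le> r) \<longrightarrow> l x = l y"
      "\<forall>x\<in>g ` A. \<forall>y\<in>g ` A. l x = l y \<longrightarrow> (\<forall>i<n. \<bar>x i - y i\<bar> \<le> M)"
    using spec[OF col[unfolded colourable_def], of r] by (elim exE conjE)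
  define D where "D = {lat n y c |c. \<forall>i<n. \<bar>c i\<bar> \<le> M} + (C + uminus ` C)"
  have CC: "(x - lat n y (g x)) - (z - lat n y (g z)) \<in> C + uminus ` C" if "x \<in> A" "z \<in> A" for x z
    by (rule mem_minus[OF bspec[OF g that(1)] bspec[OF g that(2)]]) simp
  show ?thesis
  proof (intro exI[of _ "k \<circ> g"] exI[of _ "l \<circ> g"] exI[of _ D] conjI ballI impI)
    show "rel_compact D" unfolding D_def by (intro rel_compact_plus rel_compact_box rel_compact_minus C)
    show "(k \<circ> g) x \<le> m" if "x \<in> A" for x using k(1) that by auto
    show "(l \<circ> g) x = (l \<circ> g) z" if xz: "x \<in> A" "z \<in> A" "(k \<circ> g) x = (k \<circ> g) z" "x - z \<in> B" for x z
    proof -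
      have "lat n y (\<lambda>i. g x i - g z i) \<in> B + uminus ` (C + uminus ` C)"
        by (rule mem_minus[OF xz(4) CC[OF xz(1,2)]]) (simp add: lat_diff)
      then have "\<forall>i<n. \<bar>g x i - g z i\<bar> \<le> r" using r by blast
      then show ?thesis using k(2) xz by auto
    qed
    show "x - z \<in> D" if xz: "x \<in> A" "z \<in> A" "(l \<circ> g) x = (l \<circ> g) z" for x z
    proof -
      have "\<forall>i<n. \<bar>g x i - g z i\<bar> \<le> M" using k(3) xz by auto
      then have "lat n y (\<lambda>i. g x i - g z i) \<in> {lat n y c |c. \<forall>i<n. \<bar>c i\<bar> \<le> M}" by blast
      then show ?thesis
        unfolding D_def by (rule mem_plus[OF _ CC[OF xz(1,2)]]) (simp add: lat_diff)
    qed
  qed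
qed

end

section \<open>Groups with a cocompact lattice\<close>

lemma dist_n_L2: "dist_n n v w = L2_set (\<lambda>i. v i - w i) {..<n}"
  by (simp add: dist_n_def L2_set_def)

lemma dist_n_le:
  assumes "\<And>i. i < n \<Longrightarrow> \<bar>v i - w i\<bar> \<le> r"
  shows "dist_n n v w \<le> real n * r"
proof -
  have "dist_n n v w \<le> (\<Sum>i<n. \<bar>v i - w i\<bar>)"
    unfolding dist_n_L2 by (rule L2_set_le_sum_abs)
  also have "\<dots> \<le> (\<Sum>i<n. r)" using assms by (intro sum_mono) auto
  finally show ?thesis by simp
qed

lemma abs_diff_le_dist_n:
  assumes "i < n"
  shows "\<bar>v i - w i\<bar> \<le> dist_n n v w"
proof -
  have "(v i - w i)\<^sup>2 \<le> (\<Sum>i<n. (v i - w i)\<^sup>2)"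
    using assms by (intro member_le_sum) auto
  then show ?thesis unfolding dist_n_def by (metis real_sqrt_abs real_sqrt_le_mono)
qed

lemma dist_n_commute: "dist_n n v w = dist_n n w v"
  by (simp add: dist_n_def power2_commute)

lemma Rn_entourage: "0 < r \<Longrightarrow> {(v, w). v \<in> Rn n \<and> w \<in> Rn n \<and> dist_n n v w < r} \<in> Rn_coarse n"
  unfolding Rn_coarse_def by (auto simp: sym_def dist_n_commute) (simp add: dist_n_def)

context lca_group
begin

lemma not_small_UNIV: "\<not> small_set UNIV group_coarse (UNIV :: 'a set)"
proof
  assume "small_set UNIV group_coarse (UNIV :: 'a set)"
  moreover have "large_set UNIV group_coarse (UNIV :: 'a set)"
    unfolding large_iff using rel_compact_finite[of "{0}"] by (intro exI[of _ "{0}"]) auto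
  ultimately have "large_set UNIV group_coarse ({} :: 'a set)" by (auto simp: small_set_def)
  then show False by (auto simp: large_iff)
qed

context
  fixes n :: nat and y :: "nat \<Rightarrow> 'a" and C :: "'a set"
  assumes proper: "proper_lat n y" and C: "rel_compact C" and cocompact: "\<And>x. \<exists>c. x - lat n y c \<in> C"
begin

lemma small_imp_asdim_le:
  fixes A :: "'a set"
  assumes small: "small_set UNIV group_coarse A" and "A \<noteq> {}"
  shows "0 < n \<and> asdim_le A (sub_coarse A group_coarse) (n - 1)"
proof -
  obtain g where g: "\<And>x. x - lat n y (g x) \<in> C" using cocompact by metis
  have holes: "\<exists>M. \<forall>q. \<exists>c. (\<forall>i<n. \<bar>q i - c i\<bar> \<le> M) \<and> (\<forall>s\<in>g ` A. \<exists>i<n. h < \<bar>s i - c i\<bar>)" for h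
  proof -
    \<comment> \<open>Chosen so that \<open>t - a\<close> outside \<open>K0\<close> forces the
      rounded coefficients of \<open>t\<close> and \<open>a\<close> to differ by more than
      \<open>h\<close> somewhere.\<close>
    define K0 where "K0 = (C + uminus ` C) + uminus ` {lat n y c |c. \<forall>i<n. \<bar>c i\<bar> \<le> h}"
    have "rel_compact ({0} \<union> K0)"
      unfolding K0_def by (intro rel_compact_Un rel_compact_minus C rel_compact_box) (rule rel_compact_finite, simp)
    then have K0: "rel_compact (insert 0 K0)" by simp
    obtain B where B: "rel_compact B" "\<And>x. \<exists>t. x - t \<in> B \<and> (\<forall>a\<in>A. t - a \<notin> insert 0 K0)"
      using small_imp_complement_large[OF small K0 insertI1] by blast
    obtain M where M: "\<And>c i. lat n y c \<in> B + C \<Longrightarrow> i < n \<Longrightarrow> \<bar>c i\<bar> \<le> M"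
      using proper_latD[OF proper rel_compact_plus[OF B(1) C]] by blast
    show ?thesis
    proof (intro exI[of _ M] allI)
      fix q
      obtain t where t: "lat n y q - t \<in> B" "\<And>a. a \<in> A \<Longrightarrow> t - a \<notin> insert 0 K0" using B(2) by blast
      have "lat n y (\<lambda>i. q i - g t i) \<in> B + C"
        by (rule mem_plus[OF t(1) g[of t]]) (simp add: lat_diff)
      then have 1: "\<forall>i<n. \<bar>q i - g t i\<bar> \<le> M" using M by blast
      have "\<exists>i<n. h < \<bar>g a i - g t i\<bar>" if a: "a \<in> A" for a
      proof (rule ccontr)
        assume "\<not> ?thesis"
        then have "\<forall>i<n. \<bar>g a i - g t i\<bar> \<le> h" by (meson not_le)
        then have box: "lat n y (\<lambda>i. g a i - g t i) \<in> {lat n y c |c. \<forall>i<n. \<bar>c i\<bar> \<le> h}" by blast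
        have CC: "(t - lat n y (g t)) - (a - lat n y (g a)) \<in> C + uminus ` C"
          by (rule mem_minus[OF g g]) simp
        have "t - a \<in> K0" unfolding K0_def by (rule mem_minus[OF CC box]) (simp add: lat_diff)
        then show False using t(2)[OF a] by blast
      qed
      then show "\<exists>c. (\<forall>i<n. \<bar>q i - c i\<bar> \<le> M) \<and> (\<forall>s\<in>g ` A. \<exists>i<n. h < \<bar>s i - c i\<bar>)" using 1 by blast
    qed
  qed
  \<comment> \<open>In rank 0 no coordinate can witness distance, so the hole condition would make
    \<open>A\<close> empty.\<close>
  have n: "0 < n"
  proof (rule ccontr)
    assume "\<not> 0 < n"
    then show False using holes[of 0] \<open>A \<noteq> {}\<close> by auto
  qed
  have "colourable n (g ` A) (n - 1)" by (rule colourable_if_holes[OF n holes])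
  then have "asdim_le A (sub_coarse A group_coarse) (n - 1)"
    using g by (intro asdim_leI[where 'l = "nat \<Rightarrow> int"] colouring_pullback[OF proper C, of A g]) auto
  then show ?thesis using n by blast
qed

lemma asdim_le_UNIV: "asdim_le (UNIV :: 'a set) group_coarse n"
proof -
  obtain g where g: "\<And>x. x - lat n y (g x) \<in> C" using cocompact by metis
  have "asdim_le (UNIV :: 'a set) (sub_coarse UNIV group_coarse) n"
    using g colourable_subset[OF colourable_UNIV[of n]]
    by (intro asdim_leI[where 'l = "nat \<Rightarrow> int"] colouring_pullback[OF proper C, of UNIV g]) auto
  then show ?thesis by (simp add: sub_coarse_UNIV)
qed

text \<open>Let removing \<open>A\<close> destroy the largeness of \<open>L\<close>. For each size
  \<open>p\<close> some translated cube is then too far from \<open>L - A\<close>, so all its points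
  are approximated, up to the fixed \<open>K\<close>, by points of \<open>L\<close> that lie in
  \<open>A\<close>.\<close>

lemma asdim_le_imp_small:
  fixes A :: "'a set"
  assumes asd: "asdim_le A (sub_coarse A group_coarse) (n - 1)" and n: "0 < n"
  shows "small_set UNIV group_coarse A"
proof (rule ccontr)
  assume "\<not> small_set UNIV group_coarse A"
  then obtain L where L: "large_set UNIV group_coarse L" "\<not> large_set UNIV group_coarse (L - A)"
    by (auto simp: small_set_def)
  obtain K where K: "rel_compact K" "\<And>x. \<exists>l\<in>L. x - l \<in> K" using L(1) by (auto simp: large_iff)
  have "\<not> asdim_le A (sub_coarse A group_coarse) (n - 1)"
  proof (rule not_asdim_le_if_cubes[OF proper n K(1)])
    fix p :: nat
    define B where "B = K + uminus ` {lat n y c |c. \<forall>i<n. \<bar>c i\<bar> \<le> int p}"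
    have "rel_compact B" unfolding B_def by (intro rel_compact_minus K rel_compact_box)
    then obtain t where t: "\<And>l. l \<in> L - A \<Longrightarrow> t - l \<notin> B" using L(2) unfolding large_iff by blast
    have "\<exists>b\<in>A. t + lat n y c - b \<in> K" if c: "\<forall>i<n. 0 \<le> c i \<and> c i \<le> int p" for c
    proof -
      obtain l where l: "l \<in> L" "t + lat n y c - l \<in> K" using K(2) by blast
      have "lat n y c \<in> {lat n y c |c. \<forall>i<n. \<bar>c i\<bar> \<le> int p}" using c by auto
      then have "t - l \<in> B" unfolding B_def by (rule mem_minus[OF l(2)]) simp
      then have "l \<in> A" using t l(1) by blast
      then show ?thesis using l(2) by blast
    qed
    then show "\<exists>t. \<forall>c. (\<forall>i<n. 0 \<le> c i \<and> c i \<le> int p) \<longrightarrow> (\<exists>b\<in>A. t + lat n y c - b \<in> K)" by blast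
  qed
  then show False using asd by blast
qed

text \<open>The dimension is exactly \<open>n\<close>: a smaller one would make the whole group
  small, leaving the empty set large.\<close>

lemma small_sets_eq_D_less: "small_sets (UNIV :: 'a set) group_coarse = D_less UNIV group_coarse"
proof -
  have "\<not> asdim_le (UNIV :: 'a set) group_coarse (n - 1)" if "0 < n"
    using asdim_le_imp_small[of UNIV] that not_small_UNIV by (auto simp: sub_coarse_UNIV)
  then have dim: "asdim (UNIV :: 'a set) group_coarse = ereal (real n)"
    using asdim_le_UNIV by (intro asdim_eqI) auto
  have empty: "small_set UNIV group_coarse ({} :: 'a set)" by (simp add: small_set_def)
  have "small_set UNIV group_coarse A \<longleftrightarrow> asdim A (sub_coarse A group_coarse) < asdim (UNIV :: 'a set) group_coarse"
    for A :: "'a set"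
    unfolding dim asdim_less_iff
    using small_imp_asdim_le[of A] asdim_le_imp_small[of A] empty by blast
  then show ?thesis by (auto simp: small_sets_def D_less_def)
qed

text \<open>One map takes lattice coefficients, the other evaluates the lattice at integer parts.
  The summands \<open>+ 1\<close> in the radii give the strict inequality and positivity, also for
  \<open>n = 0\<close>.\<close>

lemma coarse_equivalent_Rn: "coarse_equivalent (UNIV :: 'a set) group_coarse (Rn n) (Rn_coarse n)"
proof -
  obtain g where g: "\<And>x. x - lat n y (g x) \<in> C" using cocompact by metis
  define f where "f x = (\<lambda>i. if i < n then real_of_int (g x i) else 0)" for x
  define e where "e v = lat n y (\<lambda>i. \<lfloor>v i\<rfloor>)" for v :: "nat \<Rightarrow> real"
  define \<delta> where "\<delta> r = {(v, w). v \<in> Rn n \<and> w \<in> Rn n \<and> dist_n n v w < r}" for r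
  have f_Rn: "f x \<in> Rn n" for x by (simp add: f_def Rn_def)
  have CC: "(x - lat n y (g x)) - (z - lat n y (g z)) \<in> C + uminus ` C" for x z
    by (rule mem_minus[OF g g]) simp
  have "coarse_map UNIV group_coarse (Rn n) (Rn_coarse n) f"
    unfolding coarse_map_def
  proof (intro conjI ballI)
    show "f ` UNIV \<subseteq> Rn n" using f_Rn by auto
    fix \<epsilon> :: "('a \<times> 'a) set" assume "\<epsilon> \<in> group_coarse"
    then obtain B where B: "rel_compact B" "\<And>x y. (x, y) \<in> \<epsilon> \<Longrightarrow> x - y \<in> B" using group_coarseD by metis
    obtain M where M: "\<And>c i. lat n y c \<in> B + uminus ` (C + uminus ` C) \<Longrightarrow> i < n \<Longrightarrow> \<bar>c i\<bar> \<le> M"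
      using proper_latD[OF proper rel_compact_minus[OF B(1) rel_compact_minus[OF C C]]] by blast
    have "(f x, f z) \<in> \<delta> (real n * \<bar>of_int M\<bar> + 1)" if xz: "(x, z) \<in> \<epsilon>" for x z
    proof -
      have "lat n y (\<lambda>i. g x i - g z i) \<in> B + uminus ` (C + uminus ` C)"
        by (rule mem_minus[OF B(2)[OF xz] CC[of x z]]) (simp add: lat_diff)
      then have *: "\<bar>g x i - g z i\<bar> \<le> M" if "i < n" for i using M that by blast
      have "dist_n n (f x) (f z) \<le> real n * \<bar>of_int M\<bar>"
      proof (rule dist_n_le)
        fix i assume i: "i < n"
        have "real_of_int \<bar>g x i - g z i\<bar> \<le> \<bar>of_int M\<bar>" using *[OF i] by linarith
        then show "\<bar>f x i - f z i\<bar> \<le> \<bar>of_int M\<bar>" using i by (simp add: f_def)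
      qed
      then show ?thesis using f_Rn by (simp add: \<delta>_def)
    qed
    then have "(\<lambda>(a, b). (f a, f b)) ` \<epsilon> \<subseteq> \<delta> (real n * \<bar>of_int M\<bar> + 1)" by auto
    moreover have "\<delta> (real n * \<bar>of_int M\<bar> + 1) \<in> Rn_coarse n"
      unfolding \<delta>_def by (rule Rn_entourage) (simp add: add_nonneg_pos)
    ultimately show "\<exists>\<delta>\<in>Rn_coarse n. (\<lambda>(a, b). (f a, f b)) ` \<epsilon> \<subseteq> \<delta>" by blast
  qed
  moreover have "coarse_map (Rn n) (Rn_coarse n) UNIV group_coarse e"
    unfolding coarse_map_def
  proof (intro conjI ballI)
    fix \<epsilon> assume "\<epsilon> \<in> Rn_coarse n"
    then obtain r where r: "\<epsilon> \<subseteq> {(x, y). dist_n n x y < r}" by (auto simp: Rn_coarse_def)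
    define B where "B = {lat n y c |c. \<forall>i<n. \<bar>c i\<bar> \<le> \<lceil>r\<rceil> + 1}"
    have "(e v, e w) \<in> ent B" if vw: "(v, w) \<in> \<epsilon>" for v w
    proof -
      have "dist_n n v w < r" using r vw by blast
      then have "\<bar>\<lfloor>v i\<rfloor> - \<lfloor>w i\<rfloor>\<bar> \<le> \<lceil>r\<rceil> + 1" if "i < n" for i
        using abs_diff_le_dist_n[OF that, of v w] by linarith
      then have "lat n y (\<lambda>i. \<lfloor>v i\<rfloor> - \<lfloor>w i\<rfloor>) \<in> B" unfolding B_def by blast
      then show ?thesis by (simp add: ent_def e_def lat_diff)
    qed
    then have "(\<lambda>(a, b). (e a, e b)) ` \<epsilon> \<subseteq> ent B" by auto
    moreover have "ent B \<in> group_coarse" unfolding B_def by (intro ent_in_group_coarse rel_compact_box)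
    ultimately show "\<exists>\<delta>\<in>group_coarse. (\<lambda>(a, b). (e a, e b)) ` \<epsilon> \<subseteq> \<delta>" by blast
  qed simp
  moreover have "\<exists>\<epsilon>\<in>group_coarse. (\<lambda>x. (x, e (f x))) ` UNIV \<subseteq> \<epsilon>"
  proof (intro bexI[of _ "ent C"] image_subsetI)
    fix x
    have "e (f x) = lat n y (g x)" unfolding e_def f_def by (rule lat_cong) auto
    then show "(x, e (f x)) \<in> ent C" using g[of x] by (simp add: ent_def)
  qed (rule ent_in_group_coarse[OF C])
  moreover have "\<exists>\<epsilon>\<in>Rn_coarse n. (\<lambda>v. (v, f (e v))) ` Rn n \<subseteq> \<epsilon>"
  proof -
    obtain M where M: "\<And>c i. lat n y c \<in> C \<Longrightarrow> i < n \<Longrightarrow> \<bar>c i\<bar> \<le> M" using proper_latD[OF proper C] by blast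
    have "(v, f (e v)) \<in> \<delta> (real n * (\<bar>of_int M\<bar> + 1) + 1)" if v: "v \<in> Rn n" for v
    proof -
      have "lat n y (\<lambda>i. \<lfloor>v i\<rfloor> - g (e v) i) \<in> C" using g[of "e v"] by (simp add: lat_diff e_def)
      then have *: "\<bar>\<lfloor>v i\<rfloor> - g (e v) i\<bar> \<le> M" if "i < n" for i using M that by blast
      have "dist_n n v (f (e v)) \<le> real n * (\<bar>of_int M\<bar> + 1)"
      proof (rule dist_n_le)
        fix i assume i: "i < n"
        have "\<bar>v i - of_int (g (e v) i)\<bar> \<le> \<bar>of_int M\<bar> + 1" using *[OF i] by linarith
        then show "\<bar>v i - f (e v) i\<bar> \<le> \<bar>of_int M\<bar> + 1" using i by (simp add: f_def)
      qed
      then show ?thesis using f_Rn v by (simp add: \<delta>_def)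
    qed
    moreover have "\<delta> (real n * (\<bar>of_int M\<bar> + 1) + 1) \<in> Rn_coarse n"
      unfolding \<delta>_def by (rule Rn_entourage) (simp add: add_nonneg_pos)
    ultimately show ?thesis by blast
  qed
  ultimately show ?thesis unfolding coarse_equivalent_def by blast
qed

end

section \<open>Compact generation and coarse equivalence with Euclidean space\<close>

lemma compactly_generated_imp_cocompact_lat:
  assumes "compactly_generated TYPE('a)"
  obtains n y C where "proper_lat n (y :: nat \<Rightarrow> 'a)" "rel_compact C" "\<And>x. \<exists>c. x - lat n y c \<in> C"
proof -
  obtain K :: "'a set" where K: "compact K" "gen_subgroup K = UNIV"
    using assms by (auto simp: compactly_generated_def)
  have "rel_compact K" using K(1) by (auto simp: rel_compact_def)
  then obtain n y C where "proper_lat n y" "rel_compact C" "\<And>x. x \<in> gen_subgroup K \<Longrightarrow> \<exists>c. x - lat n y c \<in> C"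
    using gen_subgroup_cocompact_lat[OF _ proper_lat_0] by metis
  then show thesis using that K(2) by auto
qed

lemma compactly_generatedI:
  assumes "rel_compact B" "gen_subgroup B = (UNIV :: 'a set)"
  shows "compactly_generated TYPE('a)"
proof -
  obtain K where K: "compact K" "B \<subseteq> K" using assms(1) by (auto simp: rel_compact_def)
  have "gen_subgroup B \<subseteq> gen_subgroup K"
    using K(2) gen_subgroup_superset[of K] is_subgroup_gen[of K] by (intro gen_subgroup_least) auto
  then show ?thesis using assms(2) K(1) by (auto simp: compactly_generated_def)
qed

text \<open>Euclidean space is connected by chains of steps shorter than 1. Their images differ by
  elements of the one set \<open>B2\<close>, so together with the image of the origin it generates
  the image of \<open>g\<close>, and \<open>B1\<close> accounts for the distance to that
  image.\<close>

lemma coarse_equivalent_imp_compactly_generated: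
  assumes "coarse_equivalent (UNIV :: 'a set) group_coarse (Rn n) (Rn_coarse n)"
  shows "compactly_generated TYPE('a)"
proof -
  obtain f g where f: "coarse_map (UNIV :: 'a set) group_coarse (Rn n) (Rn_coarse n) f"
    and g: "coarse_map (Rn n) (Rn_coarse n) (UNIV :: 'a set) group_coarse g"
    and gf: "\<exists>\<epsilon>\<in>group_coarse. (\<lambda>x. (x, g (f x))) ` UNIV \<subseteq> \<epsilon>"
    using assms unfolding coarse_equivalent_def by blast
  obtain \<epsilon>1 where e1: "\<epsilon>1 \<in> group_coarse" "(\<lambda>x. (x, g (f x))) ` UNIV \<subseteq> \<epsilon>1" using gf by blast
  obtain B1 where B1: "rel_compact B1" "\<And>x y. (x, y) \<in> \<epsilon>1 \<Longrightarrow> x - y \<in> B1" using group_coarseD[OF e1(1)] by metis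
  have "{(v, w). v \<in> Rn n \<and> w \<in> Rn n \<and> dist_n n v w < 1} \<in> Rn_coarse n" by (rule Rn_entourage) simp
  then obtain \<epsilon>2 where e2: "\<epsilon>2 \<in> group_coarse"
    "(\<lambda>(a, b). (g a, g b)) ` {(v, w). v \<in> Rn n \<and> w \<in> Rn n \<and> dist_n n v w < 1} \<subseteq> \<epsilon>2"
    using g unfolding coarse_map_def by blast
  obtain B2 where B2: "rel_compact B2" "\<And>x y. (x, y) \<in> \<epsilon>2 \<Longrightarrow> x - y \<in> B2" using group_coarseD[OF e2(1)] by metis
  define B where "B = B1 \<union> B2 \<union> {g (\<lambda>_. 0)}"
  note G = is_subgroupD[OF is_subgroup_gen[of B]] and sup = gen_subgroup_superset[of B]
  have gR: "g v \<in> gen_subgroup B" if v: "v \<in> Rn n" for v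
  proof -
    define N where "N = nat \<lceil>dist_n n v (\<lambda>_. 0)\<rceil> + 1"
    have N: "dist_n n v (\<lambda>_. 0) < real N" unfolding N_def by linarith
    have N0: "0 < real N" by (simp add: N_def)
    \<comment> \<open>The segment from the origin to \<open>v\<close> in \<open>N\<close> steps;
      \<open>N\<close> exceeds the norm of \<open>v\<close>, so each step is shorter than 1.\<close>
    define w where "w j = (\<lambda>i. real j / real N * v i)" for j :: nat
    have wR: "w j \<in> Rn n" for j using v by (auto simp: w_def Rn_def)
    have step: "dist_n n (w j) (w (Suc j)) < 1" for j
    proof -
      have "w j i - w (Suc j) i = - (v i / real N)" for i using N0 by (simp add: w_def field_simps)
      then have "dist_n n (w j) (w (Suc j)) = sqrt (\<Sum>i<n. (v i)\<^sup>2 / (real N)\<^sup>2)"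
        by (simp add: dist_n_def power_divide)
      also have "\<dots> = dist_n n v (\<lambda>_. 0) / real N"
        by (simp add: dist_n_def real_sqrt_divide flip: sum_divide_distrib)
      also have "\<dots> < 1" using N N0 by simp
      finally show ?thesis .
    qed
    have "g (w j) \<in> gen_subgroup B" for j
    proof (induction j)
      case 0
      have "w 0 = (\<lambda>_. 0)" by (simp add: w_def)
      then show ?case using sup by (auto simp: B_def)
    next
      case (Suc j)
      have "(g (w j), g (w (Suc j))) \<in> \<epsilon>2" using e2(2) wR step by blast
      then have "g (w j) - g (w (Suc j)) \<in> gen_subgroup B" using B2(2) sup by (auto simp: B_def)
      then have "g (w j) - (g (w j) - g (w (Suc j))) \<in> gen_subgroup B" using Suc G(4) by blast
      then show ?case by simp
    qed
    moreover have "w N = v" using N0 by (simp add: w_def)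
    ultimately show ?thesis by metis
  qed
  have "x \<in> gen_subgroup B" for x
  proof -
    have "x - g (f x) \<in> gen_subgroup B" using e1(2) B1(2) sup by (auto simp: B_def)
    moreover have "g (f x) \<in> gen_subgroup B" using f by (intro gR) (auto simp: coarse_map_def)
    ultimately have "(x - g (f x)) + g (f x) \<in> gen_subgroup B" by (rule G(2))
    then show ?thesis by simp
  qed
  then have "gen_subgroup B = UNIV" by blast
  moreover have "rel_compact B"
    unfolding B_def by (intro rel_compact_Un B1 B2) (rule rel_compact_finite, simp)
  ultimately show ?thesis by (intro compactly_generatedI)
qed

section \<open>Groups that are not compactly generated\<close>

lemma maximal_lat_imp_asdim_le:
  assumes proper: "proper_lat n y" and maximal: "\<And>z. \<not> proper_lat (Suc n) (y(n := z))"
  shows "asdim_le (UNIV :: 'a set) group_coarse n"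
proof -
  have "asdim_le (UNIV :: 'a set) (sub_coarse UNIV group_coarse) n"
  proof (rule asdim_leI)
    fix B :: "'a set" assume B: "rel_compact B"
    obtain n' y' C where 1: "n \<le> n'" "\<And>i. i < n \<Longrightarrow> y' i = y i" "proper_lat n' y'" "rel_compact C"
      "\<And>x. x \<in> gen_subgroup B \<Longrightarrow> \<exists>c. x - lat n' y' c \<in> C"
      using gen_subgroup_cocompact_lat[OF B proper] by blast
    \<comment> \<open>A longer lattice would contain a proper one-step extension of
      \<open>y\<close>.\<close>
    have "n' = n"
    proof (rule ccontr)
      assume "n' \<noteq> n"
      then have "proper_lat (Suc n) (y(n := y' n))"
        using 1(1,2) by (intro proper_lat_prefix[OF 1(3)]) (auto simp: less_Suc_eq)
      then show False using maximal by blast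
    qed
    then have "\<forall>x\<in>gen_subgroup B. \<exists>c. x - lat n y c \<in> C"
      using 1(5) lat_cong[of n _ _ y' y] 1(2) by metis
    from bchoice[OF this] obtain g where g: "\<forall>x\<in>gen_subgroup B. x - lat n y (g x) \<in> C" by blast
    obtain k :: "'a \<Rightarrow> nat" and l :: "'a \<Rightarrow> nat \<Rightarrow> int" and D
      where k: "rel_compact D" "\<forall>x\<in>gen_subgroup B. k x \<le> n"
        "\<forall>x\<in>gen_subgroup B. \<forall>y\<in>gen_subgroup B. k x = k y \<longrightarrow> x - y \<in> B \<longrightarrow> l x = l y"
        "\<forall>x\<in>gen_subgroup B. \<forall>y\<in>gen_subgroup B. l x = l y \<longrightarrow> x - y \<in> D"
      using colouring_pullback[OF proper 1(4) g colourable_subset[OF colourable_UNIV subset_UNIV] B]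
      by (elim exE conjE)
    note G = is_subgroupD[OF is_subgroup_gen[of B]]
    \<comment> \<open>The chosen predicate depends only on the coset of \<open>x\<close>, hence so
      does the representative. It becomes part of the label, so that different cosets never share a
      class.\<close>
    define rep where "rep x = (SOME z. x - z \<in> gen_subgroup B)" for x
    have rep: "x - rep x \<in> gen_subgroup B" for x
      unfolding rep_def by (rule someI[of _ x]) (simp add: G)
    have rep_eq: "rep x = rep z" if "x - z \<in> gen_subgroup B" for x z
    proof -
      have "x - u \<in> gen_subgroup B \<longleftrightarrow> z - u \<in> gen_subgroup B" for u
        using G(2)[OF that, of "z - u"] G(4)[OF _ that, of "x - u"] by (auto simp: algebra_simps)
      then show ?thesis by (simp add: rep_def)
    qed
    show "\<exists>(k :: 'a \<Rightarrow> nat) (l :: 'a \<Rightarrow> (nat \<Rightarrow> int) \<times> 'a) D. rel_compact D \<and> (\<forall>x\<in>UNIV. k x \<le> n)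
      \<and> (\<forall>x\<in>UNIV. \<forall>y\<in>UNIV. k x = k y \<longrightarrow> x - y \<in> B \<longrightarrow> l x = l y) \<and> (\<forall>x\<in>UNIV. \<forall>y\<in>UNIV. l x = l y \<longrightarrow> x - y \<in> D)"
    proof (intro exI[of _ "\<lambda>x. k (x - rep x)"] exI[of _ "\<lambda>x. (l (x - rep x), rep x)"] exI[of _ D] conjI ballI impI)
      show "k (x - rep x) \<le> n" for x using k(2) rep by blast
      fix x z
      show "(l (x - rep x), rep x) = (l (z - rep z), rep z)"
        if xz: "k (x - rep x) = k (z - rep z)" "x - z \<in> B"
      proof -
        have eq: "rep x = rep z" using xz(2) gen_subgroup_superset[of B] by (intro rep_eq) auto
        then have "(x - rep x) - (z - rep z) \<in> B" using xz(2) by simp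
        then have "l (x - rep x) = l (z - rep z)" using k(3) rep xz(1) by blast
        then show ?thesis using eq by simp
      qed
      show "x - z \<in> D" if "(l (x - rep x), rep x) = (l (z - rep z), rep z)"
      proof -
        have "(x - rep x) - (z - rep z) \<in> D" using k(4) rep that by blast
        then show ?thesis using that by simp
      qed
    qed (rule k(1))
  qed
  then show ?thesis by (simp add: sub_coarse_UNIV)
qed

lemma not_asdim_le_if_lat:
  assumes "proper_lat n y" "0 < n" "range (lat n y) \<subseteq> A"
  shows "\<not> asdim_le A (sub_coarse A group_coarse) (n - 1)"
proof (rule not_asdim_le_if_cubes[OF assms(1,2) rel_compact_finite[of "{0}"]])
  show "\<exists>t. \<forall>c. (\<forall>i<n. 0 \<le> c i \<and> c i \<le> int p) \<longrightarrow> (\<exists>b\<in>A. t + lat n y c - b \<in> {0})" for p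
    using assms(3) by (intro exI[of _ 0]) auto
qed simp

text \<open>If \<open>K\<close> plus the lattice were everything, \<open>K\<close> and the finitely
  many basis elements would generate the group.\<close>

lemma small_range_lat:
  assumes not_cg: "\<not> compactly_generated TYPE('a)"
  shows "small_set UNIV group_coarse (range (lat n y) :: 'a set)"
proof (rule small_subgroup[OF is_subgroup_range_lat])
  fix K :: "'a set" assume K: "rel_compact K"
  show "\<exists>x. \<forall>h\<in>range (lat n y). x - h \<notin> K"
  proof (rule ccontr)
    assume neg: "\<not> ?thesis"
    define B where "B = K \<union> y ` {..<n}"
    note G = is_subgroupD[OF is_subgroup_gen[of B]] and sup = gen_subgroup_superset[of B]
    have "x \<in> gen_subgroup B" for x
    proof -
      obtain c where c: "x - lat n y c \<in> K" using neg by blast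
      have "lat n y c \<in> gen_subgroup B"
        using sup by (intro is_subgroup_lat is_subgroup_gen) (auto simp: B_def)
      moreover have "x - lat n y c \<in> gen_subgroup B" using c sup by (auto simp: B_def)
      ultimately have "(x - lat n y c) + lat n y c \<in> gen_subgroup B" using G(2) by blast
      then show ?thesis by simp
    qed
    then have "gen_subgroup B = UNIV" by blast
    moreover have "rel_compact B"
      unfolding B_def by (intro rel_compact_Un K) (rule rel_compact_finite, simp)
    ultimately show False using not_cg compactly_generatedI by blast
  qed
qed

lemma proper_lat_shift:
  assumes "proper_lat (Suc m) y"
  shows "proper_lat m (y \<circ> Suc)"
  unfolding proper_lat_def
proof (intro allI impI)
  fix B :: "'a set" assume "rel_compact B"
  then obtain M where M: "\<And>c i. lat (Suc m) y c \<in> B \<Longrightarrow> i < Suc m \<Longrightarrow> \<bar>c i\<bar> \<le> M"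
    using proper_latD[OF assms] by blast
  have "\<bar>c i\<bar> \<le> M" if "lat m (y \<circ> Suc) c \<in> B" "i < m" for c i
    using M[of "case_nat 0 c" "Suc i"] that by (simp add: lat_Suc_shift comp_def)
  then show "\<exists>M. \<forall>c. lat m (y \<circ> Suc) c \<in> B \<longrightarrow> (\<forall>i<m. \<bar>c i\<bar> \<le> M)" by blast
qed

text \<open>Each stage keeps all earlier entries, so the diagonal sequence agrees with every stage
  on its proper initial segment.\<close>

lemma infinite_lat_extension:
  assumes ext: "\<And>n y. proper_lat n y \<Longrightarrow> \<exists>z. proper_lat (Suc n) (y(n := z))" and start: "proper_lat d y0"
  obtains y where "\<And>i. i < d \<Longrightarrow> y i = y0 i" "\<And>m. proper_lat m y"
proof -
  have "\<exists>ys. \<forall>k. (proper_lat (d + k) (ys k) \<and> (\<forall>i<d. ys k i = y0 i)) \<and> (\<forall>i<d + k. ys (Suc k) i = ys k i)"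
  proof (rule dependent_nat_choice)
    show "\<exists>x. proper_lat (d + 0) x \<and> (\<forall>i<d. x i = y0 i)" using start by auto
    fix x k assume x: "proper_lat (d + k) x \<and> (\<forall>i<d. x i = y0 i)"
    then obtain z where "proper_lat (Suc (d + k)) (x(d + k := z))" using ext by blast
    then show "\<exists>x'. (proper_lat (d + Suc k) x' \<and> (\<forall>i<d. x' i = y0 i)) \<and> (\<forall>i<d + k. x' i = x i)"
      using x by (intro exI[of _ "x(d + k := z)"]) auto
  qed
  then obtain ys where ys: "\<And>k. proper_lat (d + k) (ys k)" "\<And>k i. i < d \<Longrightarrow> ys k i = y0 i"
    "\<And>k i. i < d + k \<Longrightarrow> ys (Suc k) i = ys k i" by blast
  have stable: "ys k' i = ys k i" if "k \<le> k'" "i < d + k" for k k' i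
    using that(1) by (induction rule: dec_induct) (use ys(3) that(2) in auto)
  define y where "y i = ys (Suc i) i" for i
  show thesis
  proof (rule that[of y])
    show "y i = y0 i" if "i < d" for i using ys(2) that by (simp add: y_def)
    show "proper_lat m y" for m
      by (rule proper_lat_prefix[OF ys(1)[of m]]) (auto simp: y_def intro!: stable)
  qed
qed

lemma small_infinite_rank_subgroup:
  assumes ext: "\<And>n y. proper_lat n (y :: nat \<Rightarrow> 'a) \<Longrightarrow> \<exists>z. proper_lat (Suc n) (y(n := z))"
  obtains A :: "'a set" where "A \<noteq> {}" "small_set UNIV group_coarse A"
    "\<And>m. \<not> asdim_le A (sub_coarse A group_coarse) m"
proof -
  obtain U V :: "'a set" where UV: "open U" "0 \<in> U" "rel_compact V"
    "\<And>a b c d. a \<in> U \<Longrightarrow> b \<in> U \<Longrightarrow> c \<in> U \<Longrightarrow> d \<in> U \<Longrightarrow> (a - b) - (c - d) \<in> V"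
    using small_neighbourhood by blast
  obtain d y0 C where d: "proper_lat d (y0 :: nat \<Rightarrow> 'a)" "rel_compact C"
    "\<And>x. x \<in> gen_subgroup V \<Longrightarrow> \<exists>c. x - lat d y0 c \<in> C"
    using gen_subgroup_cocompact_lat[OF UV(3) proper_lat_0] by metis
  obtain y where y: "\<And>i. i < d \<Longrightarrow> y i = y0 i" "\<And>m. proper_lat m y"
    using infinite_lat_extension[OF ext d(1)] by blast
  define A where "A = (\<Union>m. range (lat m (y \<circ> Suc)))"
  have lat_mono: "range (lat m (y \<circ> Suc)) \<subseteq> range (lat m' (y \<circ> Suc))" if "m \<le> m'" for m m'
  proof (rule image_subsetI)
    fix c show "lat m (y \<circ> Suc) c \<in> range (lat m' (y \<circ> Suc))"
      by (rule range_eqI, rule lat_extend[symmetric, OF that]) simp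
  qed
  have A: "is_subgroup A"
    unfolding is_subgroup_def
  proof (intro conjI ballI)
    note R = is_subgroupD[OF is_subgroup_range_lat[of _ "y \<circ> Suc"]]
    show "0 \<in> A" using R(1) by (auto simp: A_def)
    show "- a \<in> A" if "a \<in> A" for a using that R(3) unfolding A_def by blast
    fix a b assume "a \<in> A" "b \<in> A"
    then obtain m m' where "a \<in> range (lat m (y \<circ> Suc))" "b \<in> range (lat m' (y \<circ> Suc))" by (auto simp: A_def)
    then have "a \<in> range (lat (max m m') (y \<circ> Suc))" "b \<in> range (lat (max m m') (y \<circ> Suc))"
      using lat_mono[of m "max m m'"] lat_mono[of m' "max m m'"] by auto
    then have "a + b \<in> range (lat (max m m') (y \<circ> Suc))" by (rule R(2))
    then show "a + b \<in> A" unfolding A_def by blast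
  qed
  \<comment> \<open>Multiples of an element of the generated subgroup remain within \<open>C\<close>
    of the span of the first \<open>d\<close> members. So every multiple of \<open>e j\<close> is
    bounded by \<open>M\<close>, and the factor \<open>\<bar>M\<bar> + 1\<close> forces
    \<open>e j = 0\<close>.\<close>
  have in_gen: "e j = 0" if e: "lat m y e \<in> gen_subgroup V" "d \<le> m" "d \<le> j" "j < m" for m e j
  proof -
    obtain M where M: "\<And>c i. lat m y c \<in> C \<Longrightarrow> i < m \<Longrightarrow> \<bar>c i\<bar> \<le> M" using proper_latD[OF y(2) d(2)] by blast
    have "zmul (\<bar>M\<bar> + 1) (lat m y e) \<in> gen_subgroup V" by (intro is_subgroup_zmul is_subgroup_gen e)
    then obtain c where c: "zmul (\<bar>M\<bar> + 1) (lat m y e) - lat d y0 c \<in> C" using d(3) by blast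
    have "lat d y0 c = lat m y (\<lambda>i. if i < d then c i else 0)"
      using lat_extend[OF e(2), of y y0 c] y(1) by simp
    then have "lat m y (\<lambda>i. (\<bar>M\<bar> + 1) * e i - (if i < d then c i else 0)) \<in> C"
      using c by (simp add: zmul_lat lat_diff)
    from M[OF this e(4)] have "\<bar>(\<bar>M\<bar> + 1) * e j\<bar> \<le> M" using e(3) by simp
    then have "(\<bar>M\<bar> + 1) * \<bar>e j\<bar> \<le> \<bar>M\<bar>" by (simp add: abs_mult)
    also have "\<bar>M\<bar> < (\<bar>M\<bar> + 1) * 1" by simp
    finally have "\<bar>e j\<bar> < 1" by (rule mult_left_less_imp_less) simp
    then show ?thesis by linarith
  qed
  have "small_set UNIV group_coarse A"
  proof (rule small_subgroup[OF A], rule ccontr)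
    fix K :: "'a set" assume K: "rel_compact K" and neg: "\<not> (\<exists>x. \<forall>h\<in>A. x - h \<notin> K)"
    obtain F where F: "finite F" "\<And>b. b \<in> K \<Longrightarrow> \<exists>f\<in>F. b - f \<in> U"
      using rel_compact_cover[OF K UV(1,2)] by blast
    \<comment> \<open>If \<open>A + K\<close> were everything, all multiples of the omitted
      \<open>y 0\<close> would return to \<open>K\<close> modulo \<open>A\<close>. Infinitely many
      of these returns share a translate of \<open>U\<close>, so their differences lie in
      \<open>V\<close>.\<close>
    have "\<forall>N::nat. \<exists>a. a \<in> A \<and> zmul (int N) (y 0) - a \<in> K" using neg by blast
    from choice[OF this] obtain a where a: "\<And>N. a N \<in> A" "\<And>N. zmul (int N) (y 0) - a N \<in> K" by blast
    have "\<forall>N. \<exists>f. f \<in> F \<and> zmul (int N) (y 0) - a N - f \<in> U" using F(2)[OF a(2)] by blast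
    from choice[OF this] obtain f where f: "\<And>N. f N \<in> F" "\<And>N. zmul (int N) (y 0) - a N - f N \<in> U" by blast
    have "finite (range f)" using f(1) F(1) by (meson finite_subset image_subsetI)
    then obtain N0 where N0: "infinite {N \<in> UNIV. f N = f N0}"
      using pigeonhole_infinite[of UNIV f] by auto
    \<comment> \<open>The rank \<open>max d 1\<close> keeps coordinate 0 in range even if
      \<open>d = 0\<close>. It does not depend on \<open>N\<close>, so this bound is
      uniform.\<close>
    obtain M where M: "\<And>c i. lat (max d 1) y c \<in> K + uminus ` K \<Longrightarrow> i < max d 1 \<Longrightarrow> \<bar>c i\<bar> \<le> M"
      using proper_latD[OF y(2) rel_compact_minus[OF K K]] by blast
    have "{N \<in> UNIV. f N = f N0} \<subseteq> {..N0 + nat M}"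
    proof (rule subsetI)
      fix N assume "N \<in> {N \<in> UNIV. f N = f N0}"
      then have fN: "f N = f N0" by simp
      define v where "v N = zmul (int N) (y 0) - a N" for N
      obtain m1 c1 where m1: "a N = lat m1 (y \<circ> Suc) c1" using a(1)[of N] by (auto simp: A_def)
      obtain m2 c2 where m2: "a N0 = lat m2 (y \<circ> Suc) c2" using a(1)[of N0] by (auto simp: A_def)
      define m where "m = max d (max m1 m2)"
      define c1' c2' where "c1' = (\<lambda>i. if i < m1 then c1 i else 0)" and "c2' = (\<lambda>i. if i < m2 then c2 i else 0)"
      have a12: "a N = lat m (y \<circ> Suc) c1'" "a N0 = lat m (y \<circ> Suc) c2'"
        unfolding m1 m2 c1'_def c2'_def by (intro lat_extend[symmetric]; simp add: m_def)+
      \<comment> \<open>Coefficient 0 is the difference of the two multiples of \<open>y 0\<close>;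
        the others come from \<open>A\<close>, shifted by one place.\<close>
      define e where "e = case_nat (int N - int N0) (\<lambda>i. c2' i - c1' i)"
      have ve: "v N - v N0 = lat (Suc m) y e"
        by (simp add: lat_Suc_shift e_def comp_def lat_diff a12[symmetric, unfolded comp_def] zmul_diff v_def algebra_simps)
      have "((v N - f N) - (v N0 - f N0)) - (0 - 0) \<in> V"
        unfolding v_def by (intro UV(4) f UV(2))
      then have "v N - v N0 \<in> V" using fN by simp
      then have "lat (Suc m) y e \<in> gen_subgroup V" using gen_subgroup_superset[of V] ve by auto
      then have e0: "e j = 0" if "d \<le> j" "j < Suc m" for j using in_gen[of "Suc m" e j] that by (simp add: m_def)
      have "lat (Suc m) y e = lat (Suc m) y (\<lambda>i. if i < max d 1 then e i else 0)"
        using e0 by (intro lat_cong) auto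
      also have "\<dots> = lat (max d 1) y e" by (rule lat_extend) (auto simp: m_def)
      finally have "lat (max d 1) y e = v N - v N0" using ve by simp
      also have "\<dots> \<in> K + uminus ` K" unfolding v_def by (rule mem_minus[OF a(2) a(2)]) simp
      finally have "\<bar>e 0\<bar> \<le> M" by (rule M) simp
      then show "N \<in> {..N0 + nat M}" by (simp add: e_def)
    qed
    then show False using N0 finite_subset by blast
  qed
  moreover have "\<not> asdim_le A (sub_coarse A group_coarse) m" for m
    using not_asdim_le_if_lat[OF proper_lat_shift[OF y(2)], of "Suc m" A] by (auto simp: A_def)
  moreover have "A \<noteq> {}" using is_subgroupD(1)[OF A] by blast
  ultimately show thesis using that by blast
qed

lemma small_sets_eq_D_less_imp_compactly_generated:
  assumes eq: "small_sets (UNIV :: 'a set) group_coarse = D_less UNIV group_coarse"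
  shows "compactly_generated TYPE('a)"
proof (rule ccontr)
  assume not_cg: "\<not> compactly_generated TYPE('a)"
  have small_dim: "asdim A (sub_coarse A group_coarse) < asdim (UNIV :: 'a set) group_coarse"
    if "small_set UNIV group_coarse A" for A :: "'a set"
    using eq that by (auto simp: small_sets_def D_less_def)
  show False
  proof (cases "\<forall>n y. proper_lat n (y :: nat \<Rightarrow> 'a) \<longrightarrow> (\<exists>z. proper_lat (Suc n) (y(n := z)))")
    case True
    then obtain A :: "'a set" where "A \<noteq> {}" "small_set UNIV group_coarse A"
      "\<And>m. \<not> asdim_le A (sub_coarse A group_coarse) m"
      using small_infinite_rank_subgroup by blast
    note A = this
    have "asdim A (sub_coarse A group_coarse) = \<infinity>" using A(1,3) by (auto simp: asdim_def)
    then show False using small_dim[OF A(2)] by simp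
  next
    case False
    then obtain n and y :: "nat \<Rightarrow> 'a" where ny: "proper_lat n y" "\<And>z. \<not> proper_lat (Suc n) (y(n := z))" by blast
    let ?L = "range (lat n y)"
    have "asdim ?L (sub_coarse ?L group_coarse) < ereal (real n)"
      using small_dim[OF small_range_lat[OF not_cg, of n y]]
        asdim_le_imp[OF maximal_lat_imp_asdim_le[OF ny]] by (rule less_le_trans)
    \<comment> \<open>In rank 0 the lattice is still nonempty, so its dimension is not below 0
      either.\<close>
    then show False using not_asdim_le_if_lat[OF ny(1) _ order_refl] by (auto simp: asdim_less_iff)
  qed
qed

end

theorem theorem1p7:
  assumes add_cont: "continuous_on UNIV (\<lambda>p::'a::{ab_group_add, t2_space} \<times> 'a. fst p + snd p)"
    and neg_cont: "continuous_on UNIV (\<lambda>x::'a. - x)"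
    and loc_compact: "locally_compact_space (euclidean :: 'a topology)"
  shows "(small_sets (UNIV::'a set) group_coarse = D_less (UNIV::'a set) group_coarse
            \<longleftrightarrow> compactly_generated TYPE('a))
       \<and> (compactly_generated TYPE('a)
            \<longleftrightarrow> (\<exists>n::nat. coarse_equivalent (UNIV::'a set) group_coarse (Rn n) (Rn_coarse n)))"
proof -
  interpret lca_group "TYPE('a)" by unfold_locales (fact assms)+
  have "small_sets (UNIV::'a set) group_coarse = D_less UNIV group_coarse"
    "\<exists>n. coarse_equivalent (UNIV::'a set) group_coarse (Rn n) (Rn_coarse n)"
    if cg: "compactly_generated TYPE('a)"
  proof -
    obtain n y C where "proper_lat n (y :: nat \<Rightarrow> 'a)" "rel_compact C" "\<And>x. \<exists>c. x - lat n y c \<in> C"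
      using compactly_generated_imp_cocompact_lat[OF cg] by blast
    note lat = this
    show "small_sets (UNIV::'a set) group_coarse = D_less UNIV group_coarse"
      by (rule small_sets_eq_D_less[OF lat])
    show "\<exists>n. coarse_equivalent (UNIV::'a set) group_coarse (Rn n) (Rn_coarse n)"
      using coarse_equivalent_Rn[OF lat] by blast
  qed
  then show ?thesis
    using small_sets_eq_D_less_imp_compactly_generated coarse_equivalent_imp_compactly_generated by blast
qed

end
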